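(* Let $G$ be a finitely presented group with decidable word problem and let $H$ be a finitely generated subgroup of $G$ with undecidable membership problem. Then the free idempotent generated semigroup $\mathsf{IG}(\mathcal{B}_{G,H})$ over the finite band $B_{G,H}$ has the following properties: (i) every non-trivial maximal subgroup of $\mathsf{IG}(\mathcal{B}_{G,H})$ is isomorphic to $G$, and so every maximal subgroup of $\mathsf{IG}(\mathcal{B}_{G,H})$ has decidable word problem; while (ii) the semigroup $\mathsf{IG}(\mathcal{B}_{G,H})$ has undecidable word problem.
   Context: Free idempotent generated semigroups. For a semigroup $S$ with set of idempotents $E$, a pair $(e,f)\in E\times E$ is a basic pair if $\{e,f\}\cap\{ef,fe\}\neq\varnothing$; then $ef\in E$. The biordered set $\mathcal{E}$ of $S$ is the set $E$ with the partial multiplication $e*f=ef$ defined exactly on basic pairs. $\mathsf{IG}(\mathcal{E})$ is the semigroup given by the presentation $\langle E\mid ef=e*f\ ((e,f)\text{ a basic pair})\rangle$. Maximal subgroups of a semigroup are the $\mathscr{H}$-classes of idempotents. A band is a semigroup of idempotents. The band $B_{G,H}$. Let $G=\langle A\mid\mathcal{R}\rangle$ be a finite group presentation and $H\le G$ a finitely generated subgroup such that (G1) every relation in $\mathcal{R}$ has the form $ab=c$ with $a,b,c\in A$; (G2) $H$ is generated by a set $B\subseteq A$ with $B^{-1}=B$ (every inverse of a generator in $B$ is a generator in $B$), so every element of $H$ is a product of elements of $B$. (Every finitely presented group with a finitely generated subgroup admits such a presentation; $B_{G,H}$ is constructed from such a choice.) Let $1,\infty$ be symbols not in $A$, $A_1=A\cup\{1\}$,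 $B_1=B\cup\{1\}$, $\overline{A}_1=\{\overline a: a\in A_1\}$ a disjoint copy of $A_1$, $I=A_1\cup\overline{A}_1$, $J=A_1\cup\{\infty\}$. Let $\mathcal{T}=\mathcal{T}^{(l)}_I\times\mathcal{T}^{(r)}_J$, where $\mathcal{T}^{(l)}_I$ is the semigroup of all maps $I\to I$ written on the left and $\mathcal{T}^{(r)}_J$ the semigroup of all maps $J\to J$ written on the right. Let $K_G\subseteq\mathcal{T}$ be the set of pairs of constant maps, identified with the rectangular band $I\times J$. Let $L_G\subseteq\mathcal{T}$ consist of the following pairs $(\sigma,\tau)$; in each, $\sigma^2=\sigma$, $\tau^2=\tau$, $\ker\sigma$ has classes $A_1,\overline{A}_1$, and $\operatorname{im}\tau=A_1$, so the pair is determined by $\operatorname{im}\sigma$ and $(\infty)\tau$: - $e_a$ for $a\in A_1$: $\operatorname{im}\sigma=\{1,\overline a\}$, $(\infty)\tau=a$; - $e_{\overline a}$ for $a\in A_1$: $\operatorname{im}\sigma=\{a,\overline a\}$, $(\infty)\tau=1$; - $e_{r}$ for each relation $r:\ ab=c$ in $\mathcal{R}$: $\operatorname{im}\sigma=\{b,\overline c\}$, $(\infty)\tau=a$. Then $B_G=K_G\cup L_G$ is a band with ideal $K_G$. Put $K_H=A_1\times B_1\subseteq K_G$; $K_H\cup L_G$ is a subband of $B_G$. Let $W=B_G\cup B_G^{(1)}\cup B_G^{(2)}\cup\{0\}$, where $s\mapsto s^{(n)}$ ($n=1,2$) are isomorphisms onto disjoint copies of $B_G$, $0$ is a zero, and $st^{(n)}=s^{(n)}t=(st)^{(n)}$,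 $s^{(1)}t^{(2)}=s^{(2)}t^{(1)}=0$ for $s,t\in B_G$. Then $B_{G,H}=L_G\cup K_H\cup K_G^{(1)}\cup K_G^{(2)}\cup\{0\}$, a finite subband of $W$, and $\mathcal{B}_{G,H}$ denotes its biordered set. The membership problem for $H$ in $G$: given a word over the generators of $G$ and their inverses, decide whether it represents an element of $H$. *)

theory Defs
  imports "HOL-Algebra.Generated_Groups" "HOL-Library.Nat_Bijection"
begin

section \<open>Decidable languages\<close>

text \<open>
  Kleene's (total) general recursive functions. \<open>recursive_fn n f\<close> says that \<open>f\<close>, applied
  to argument lists of length \<open>n\<close>, is general recursive; values of \<open>f\<close> on lists of other lengths
  carry no meaning. Minimisation is only applied to regular functions, so all functions are total.
\<close>

inductive recursive_fn :: "nat \<Rightarrow> (nat list \<Rightarrow> nat) \<Rightarrow> bool" where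
  zero: "recursive_fn n (\<lambda>xs. 0)"
| succ: "recursive_fn 1 (\<lambda>xs. Suc (xs ! 0))"
| proj: "i < n \<Longrightarrow> recursive_fn n (\<lambda>xs. xs ! i)"
| comp: "recursive_fn (length gs) f \<Longrightarrow> \<forall>g\<in>set gs. recursive_fn n g
    \<Longrightarrow> recursive_fn n (\<lambda>xs. f (map (\<lambda>g. g xs) gs))"
| prec: "recursive_fn n f \<Longrightarrow> recursive_fn (Suc (Suc n)) g
    \<Longrightarrow> recursive_fn (Suc n) (\<lambda>xs. rec_nat (f (tl xs)) (\<lambda>k y. g (k # y # tl xs)) (hd xs))"
| minim: "recursive_fn (Suc n) f \<Longrightarrow> \<forall>xs. length xs = n \<longrightarrow> (\<exists>k. f (k # xs) = 0)
    \<Longrightarrow> recursive_fn n (\<lambda>xs. LEAST k. f (k # xs) = 0)"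

definition recursive_set :: "nat set \<Rightarrow> bool" where
  "recursive_set S \<longleftrightarrow> (\<exists>f. recursive_fn 1 f \<and> (\<forall>x. f [x] = (if x \<in> S then 1 else 0)))"

text \<open>
  Decidability of a set of words over a finite alphabet \<open>X\<close>, and of a set of pairs of such words.
  Letters are numbered by an injection \<open>c\<close>; as \<open>X\<close> is finite, all choices of \<open>c\<close> give the same
  notion.
\<close>

definition decidable_words :: "'x set \<Rightarrow> 'x list set \<Rightarrow> bool" where
  "decidable_words X P \<longleftrightarrow>
     (\<exists>c. inj_on c X \<and> recursive_set ((\<lambda>w. list_encode (map c w)) ` P))"

definition decidable_word_pairs :: "'x set \<Rightarrow> ('x list \<times> 'x list) set \<Rightarrow> bool" where
  "decidable_word_pairs X P \<longleftrightarrow>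
     (\<exists>c. inj_on c X \<and>
        recursive_set ((\<lambda>(u, v). prod_encode (list_encode (map c u), list_encode (map c v))) ` P))"


section \<open>Presentations\<close>

text \<open>The least congruence on the free monoid over \<open>X\<close> that contains the relations \<open>Q\<close>.\<close>

inductive pres_cong :: "'x set \<Rightarrow> ('x list \<times> 'x list) set \<Rightarrow> 'x list \<Rightarrow> 'x list \<Rightarrow> bool"
  for X Q where
  rel: "(u, v) \<in> Q \<Longrightarrow> u \<in> lists X \<Longrightarrow> v \<in> lists X \<Longrightarrow> pres_cong X Q u v"
| refl: "w \<in> lists X \<Longrightarrow> pres_cong X Q w w"
| sym: "pres_cong X Q u v \<Longrightarrow> pres_cong X Q v u"
| trans: "pres_cong X Q u v \<Longrightarrow> pres_cong X Q v w \<Longrightarrow> pres_cong X Q u w"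
| mult: "pres_cong X Q u v \<Longrightarrow> pres_cong X Q u' v' \<Longrightarrow> pres_cong X Q (u @ u') (v @ v')"

text \<open>Group words: the letter \<open>(a, True)\<close> stands for \<open>a\<close> and \<open>(a, False)\<close> for the inverse of \<open>a\<close>.\<close>

definition letter_val :: "'g monoid \<Rightarrow> ('a \<Rightarrow> 'g) \<Rightarrow> 'a \<times> bool \<Rightarrow> 'g" where
  "letter_val G \<phi> x = (if snd x then \<phi> (fst x) else inv\<^bsub>G\<^esub> (\<phi> (fst x)))"

definition word_val :: "'g monoid \<Rightarrow> ('a \<Rightarrow> 'g) \<Rightarrow> ('a \<times> bool) list \<Rightarrow> 'g" where
  "word_val G \<phi> w = foldr (\<lambda>x g. letter_val G \<phi> x \<otimes>\<^bsub>G\<^esub> g) w \<one>\<^bsub>G\<^esub>"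

definition free_reductions :: "(('a \<times> bool) list \<times> ('a \<times> bool) list) set" where
  "free_reductions = {([(a, p), (a, \<not> p)], []) | a p. True}"

text \<open>
  \<open>G\<close> is the group presented by generators \<open>'a\<close> and relations \<open>Q\<close>, where \<open>\<phi>\<close> sends each
  generating symbol to the element of \<open>G\<close> that it represents. (\<open>\<phi>\<close> need not be injective.)
\<close>

definition group_presentation ::
  "'g monoid \<Rightarrow> ('a \<Rightarrow> 'g) \<Rightarrow> (('a \<times> bool) list \<times> ('a \<times> bool) list) set \<Rightarrow> bool" where
  "group_presentation G \<phi> Q \<longleftrightarrow>
     group G \<and> range \<phi> \<subseteq> carrier G \<and> generate G (range \<phi>) = carrier G \<and>
     (\<forall>u v. word_val G \<phi> u = word_val G \<phi> v \<longleftrightarrow> pres_cong UNIV (Q \<union> free_reductions) u v)"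

text \<open>The triple \<open>(a, b, c)\<close> encodes the relation \<open>ab = c\<close>.\<close>

definition triple_relations ::
  "('a \<times> 'a \<times> 'a) set \<Rightarrow> (('a \<times> bool) list \<times> ('a \<times> bool) list) set" where
  "triple_relations R = {([(a, True), (b, True)], [(c, True)]) | a b c. (a, b, c) \<in> R}"


section \<open>Decision problems for groups\<close>

text \<open>
  A property of the abstract group: the word problem is decidable with respect to some finite
  generating set (equivalently, it is finitely generated and the word problem is decidable with
  respect to every finite generating set).
\<close>

definition decidable_word_problem :: "'g monoid \<Rightarrow> bool" where
  "decidable_word_problem G \<longleftrightarrow>
     group G \<and>
     (\<exists>X. finite X \<and> X \<subseteq> carrier G \<and> generate G X = carrier G \<and>
        decidable_words (X \<times> UNIV) {w \<in> lists (X \<times> UNIV). word_val G id w = \<one>\<^bsub>G\<^esub>})"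

text \<open>Membership problem for \<open>H\<close> in \<open>G\<close>, over the generators \<open>\<phi> a\<close> and their inverses.\<close>

definition decidable_membership :: "'g monoid \<Rightarrow> ('a::finite \<Rightarrow> 'g) \<Rightarrow> 'g set \<Rightarrow> bool" where
  "decidable_membership G \<phi> H \<longleftrightarrow> decidable_words UNIV {w. word_val G \<phi> w \<in> H}"


section \<open>Semigroups and maximal subgroups\<close>

record 'a semigrp = "'a partial_object" +
  smult :: "'a \<Rightarrow> 'a \<Rightarrow> 'a" (infixl \<open>\<odot>\<index>\<close> 70)

definition idempotents :: "'a semigrp \<Rightarrow> 'a set" where
  "idempotents S = {e \<in> carrier S. e \<odot>\<^bsub>S\<^esub> e = e}"

definition is_band :: "'a semigrp \<Rightarrow> bool" where
  "is_band S \<longleftrightarrow>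
     (\<forall>x\<in>carrier S. \<forall>y\<in>carrier S. x \<odot>\<^bsub>S\<^esub> y \<in> carrier S) \<and>
     (\<forall>x\<in>carrier S. \<forall>y\<in>carrier S. \<forall>z\<in>carrier S.
        (x \<odot>\<^bsub>S\<^esub> y) \<odot>\<^bsub>S\<^esub> z = x \<odot>\<^bsub>S\<^esub> (y \<odot>\<^bsub>S\<^esub> z)) \<and>
     idempotents S = carrier S"

definition right_ideal :: "'a semigrp \<Rightarrow> 'a \<Rightarrow> 'a set" where
  "right_ideal S x = insert x ((\<lambda>s. x \<odot>\<^bsub>S\<^esub> s) ` carrier S)"

definition left_ideal :: "'a semigrp \<Rightarrow> 'a \<Rightarrow> 'a set" where
  "left_ideal S x = insert x ((\<lambda>s. s \<odot>\<^bsub>S\<^esub> x) ` carrier S)"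

text \<open>Green's relation \<open>\<H> = \<R> \<inter> \<L>\<close>, via equality of principal one-sided ideals.\<close>

definition H_class :: "'a semigrp \<Rightarrow> 'a \<Rightarrow> 'a set" where
  "H_class S x = {y \<in> carrier S. right_ideal S x = right_ideal S y \<and> left_ideal S x = left_ideal S y}"

definition maximal_subgroup :: "'a semigrp \<Rightarrow> 'a \<Rightarrow> 'a monoid" where
  "maximal_subgroup S e = \<lparr>carrier = H_class S e, mult = smult S, one = e\<rparr>"

definition maximal_subgroups :: "'a semigrp \<Rightarrow> 'a monoid set" where
  "maximal_subgroups S = maximal_subgroup S ` idempotents S"


section \<open>Biordered sets and free idempotent generated semigroups\<close>

record 'a biordered = "'a partial_object" +
  pmult :: "'a \<Rightarrow> 'a \<Rightarrow> 'a option"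

definition basic_pair :: "'a semigrp \<Rightarrow> 'a \<Rightarrow> 'a \<Rightarrow> bool" where
  "basic_pair S e f \<longleftrightarrow> e \<in> idempotents S \<and> f \<in> idempotents S \<and>
     {e, f} \<inter> {e \<odot>\<^bsub>S\<^esub> f, f \<odot>\<^bsub>S\<^esub> e} \<noteq> {}"

definition biordered_set :: "'a semigrp \<Rightarrow> 'a biordered" where
  "biordered_set S =
     \<lparr>carrier = idempotents S,
      pmult = (\<lambda>e f. if basic_pair S e f then Some (e \<odot>\<^bsub>S\<^esub> f) else None)\<rparr>"

definition IG_relations :: "'a biordered \<Rightarrow> ('a list \<times> 'a list) set" where
  "IG_relations \<E> = {([e, f], [g]) | e f g.
     e \<in> carrier \<E> \<and> f \<in> carrier \<E> \<and> pmult \<E> e f = Some g}"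

text \<open>
  The element of \<open>IG(\<E>)\<close> represented by a word. Both sides of every defining relation are
  non-empty, so on non-empty words the monoid congruence is the semigroup congruence.
\<close>

definition IG_class :: "'a biordered \<Rightarrow> 'a list \<Rightarrow> 'a list set" where
  "IG_class \<E> w = {v. pres_cong (carrier \<E>) (IG_relations \<E>) w v}"

definition IG :: "'a biordered \<Rightarrow> 'a list set semigrp" where
  "IG \<E> =
     \<lparr>carrier = IG_class \<E> ` (lists (carrier \<E>) - {[]}),
      smult = (\<lambda>C D. \<Union>u\<in>C. \<Union>v\<in>D. IG_class \<E> (u @ v))\<rparr>"

definition IG_decidable_word_problem :: "'a biordered \<Rightarrow> bool" where
  "IG_decidable_word_problem \<E> \<longleftrightarrow>
     decidable_word_pairs (carrier \<E>)
       {(u, v). u \<in> lists (carrier \<E>) - {[]} \<and> v \<in> lists (carrier \<E>) - {[]} \<and>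
                IG_class \<E> u = IG_class \<E> v}"


section \<open>The band \<open>B\<^bsub>G,H\<^esub>\<close>\<close>

text \<open>
  The generating symbols are the elements of a finite type \<open>'a\<close>. In \<open>'a A1\<close>, \<open>None\<close> is the extra
  symbol \<open>1\<close>; in \<open>'a I\<close>, \<open>Inl x\<close> is \<open>x\<close> and \<open>Inr x\<close> is its barred copy; in \<open>'a J\<close>, \<open>None\<close> is
  \<open>\<infinity>\<close>.
\<close>

type_synonym 'a A1 = "'a option"
type_synonym 'a I = "'a A1 + 'a A1"
type_synonym 'a J = "'a A1 option"
type_synonym 'a T = "('a I \<Rightarrow> 'a I) \<times> ('a J \<Rightarrow> 'a J)"

text \<open>Maps on \<open>'a I\<close> are written on the left, maps on \<open>'a J\<close> on the right.\<close>

definition T_mult :: "'a T \<Rightarrow> 'a T \<Rightarrow> 'a T" where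
  "T_mult s t = (fst s \<circ> fst t, snd t \<circ> snd s)"

definition K_pair :: "'a I \<Rightarrow> 'a J \<Rightarrow> 'a T" where
  "K_pair i j = (\<lambda>_. i, \<lambda>_. j)"

definition K_G :: "'a T set" where
  "K_G = {K_pair i j | i j. True}"

text \<open>The pair with image of \<open>\<sigma>\<close> equal to \<open>{x, \<^bold>y}\<close> (\<open>\<^bold>y\<close> the barred copy of \<open>y\<close>) and \<open>(\<infinity>)\<tau> = z\<close>.\<close>

definition L_pair :: "'a A1 \<Rightarrow> 'a A1 \<Rightarrow> 'a A1 \<Rightarrow> 'a T" where
  "L_pair x y z =
     (\<lambda>i. case i of Inl _ \<Rightarrow> Inl x | Inr _ \<Rightarrow> Inr y,
      \<lambda>j. case j of Some w \<Rightarrow> Some w | None \<Rightarrow> Some z)"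

lemma L_pair_unique:
  fixes \<sigma> :: "'a I \<Rightarrow> 'a I" and \<tau> :: "'a J \<Rightarrow> 'a J"
  shows "(\<sigma>, \<tau>) = L_pair x y z \<longleftrightarrow>
     \<sigma> \<circ> \<sigma> = \<sigma> \<and> \<tau> \<circ> \<tau> = \<tau> \<and>
     (\<forall>i i'. \<sigma> i = \<sigma> i' \<longleftrightarrow> (i \<in> range Inl \<longleftrightarrow> i' \<in> range Inl)) \<and> range \<tau> = range Some \<and>
     range \<sigma> = {Inl x, Inr y} \<and> \<tau> None = Some z"
proof (intro iffI, goal_cases)
  case 1
  then have \<sigma>: "\<sigma> (Inl u) = Inl x" "\<sigma> (Inr u) = Inr y"
    and \<tau>: "\<tau> None = Some z" "\<tau> (Some u) = Some u" for u
    by (simp_all add: L_pair_def)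
  have "\<sigma> i = \<sigma> i' \<longleftrightarrow> (i \<in> range Inl \<longleftrightarrow> i' \<in> range Inl)" for i i'
    by (cases i; cases i') (auto simp: \<sigma>)
  moreover have \<sigma>': "\<sigma> (\<sigma> i) = \<sigma> i" "\<sigma> i \<in> {Inl x, Inr y}" for i
    by (cases i; simp add: \<sigma>)+
  moreover have \<tau>': "\<tau> (\<tau> j) = \<tau> j" "\<tau> j \<in> range Some" for j
    by (cases j; simp add: \<tau>)+
  moreover have "range \<sigma> = {Inl x, Inr y}"
    using \<sigma>'(2) \<sigma>[symmetric] by blast
  moreover have "range \<tau> = range Some"
    using \<tau>'(2) \<tau>(2)[symmetric] by blast
  ultimately show ?case
    by (simp only: fun_eq_iff o_apply \<tau>(1)) simp
next
  case 2
  then have idem: "\<And>i. \<sigma> (\<sigma> i) = \<sigma> i" "\<And>j. \<tau> (\<tau> j) = \<tau> j"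
    and ker: "\<And>i i'. \<sigma> i = \<sigma> i' \<longleftrightarrow> (i \<in> range Inl \<longleftrightarrow> i' \<in> range Inl)"
    and im: "range \<tau> = range Some" "range \<sigma> = {Inl x, Inr y}" and inf: "\<tau> None = Some z"
    by (auto simp: fun_eq_iff)
  have "\<sigma> (Inl x) = Inl x" "\<sigma> (Inr y) = Inr y"
    using idem(1) im(2) by (metis insertI1 insertI2 rangeE)+
  moreover have "\<sigma> (Inl u) = \<sigma> (Inl x)" "\<sigma> (Inr u) = \<sigma> (Inr y)" for u
    by (auto simp: ker)
  moreover have "\<tau> (Some w) = Some w" for w
    using idem(2) im(1) by (metis rangeE rangeI)
  ultimately show ?case
    by (auto simp: L_pair_def fun_eq_iff inf split: sum.splits option.splits)
qed

definition L_G :: "('a \<times> 'a \<times> 'a) set \<Rightarrow> 'a T set" where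
  "L_G R =
     {L_pair None a a | a. True} \<union>
     {L_pair a a None | a. True} \<union>
     {L_pair (Some b) (Some c) (Some a) | a b c. (a, b, c) \<in> R}"

definition K_H :: "'a set \<Rightarrow> 'a T set" where
  "K_H B = {K_pair (Inl a) (Some b) | a b. b \<in> insert None (Some ` B)}"

datatype 's W = Base 's | Copy1 's | Copy2 's | Zero

fun W_mult :: "('s \<Rightarrow> 's \<Rightarrow> 's) \<Rightarrow> 's W \<Rightarrow> 's W \<Rightarrow> 's W" where
  "W_mult m (Base s) (Base t) = Base (m s t)"
| "W_mult m (Base s) (Copy1 t) = Copy1 (m s t)"
| "W_mult m (Base s) (Copy2 t) = Copy2 (m s t)"
| "W_mult m (Copy1 s) (Base t) = Copy1 (m s t)"
| "W_mult m (Copy2 s) (Base t) = Copy2 (m s t)"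
| "W_mult m (Copy1 s) (Copy1 t) = Copy1 (m s t)"
| "W_mult m (Copy2 s) (Copy2 t) = Copy2 (m s t)"
| "W_mult m (Copy1 s) (Copy2 t) = Zero"
| "W_mult m (Copy2 s) (Copy1 t) = Zero"
| "W_mult m Zero t = Zero"
| "W_mult m s Zero = Zero"

definition B_GH :: "('a \<times> 'a \<times> 'a) set \<Rightarrow> 'a set \<Rightarrow> 'a T W semigrp" where
  "B_GH R B =
     \<lparr>carrier = Base ` (L_G R \<union> K_H B) \<union> Copy1 ` K_G \<union> Copy2 ` K_G \<union> {Zero},
      smult = W_mult T_mult\<rparr>"

lemma finite_B_GH: "finite (carrier (B_GH R B :: ('a::finite) T W semigrp))"
  by (simp add: B_GH_def)

lemma T_mult_K_K: "T_mult (K_pair i j) (K_pair k l) = K_pair i l"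
  by (simp add: T_mult_def K_pair_def fun_eq_iff)

lemma T_mult_L_L: "T_mult (L_pair x y z) (L_pair x' y' z') = L_pair x y z"
  by (auto simp: T_mult_def L_pair_def fun_eq_iff split: sum.splits option.splits)

lemma T_mult_L_K: "T_mult (L_pair x y z) (K_pair i j) =
    K_pair (case i of Inl _ \<Rightarrow> Inl x | Inr _ \<Rightarrow> Inr y) j"
  by (simp add: T_mult_def L_pair_def K_pair_def fun_eq_iff)

lemma T_mult_K_L: "T_mult (K_pair i j) (L_pair x y z) =
    K_pair i (case j of Some w \<Rightarrow> Some w | None \<Rightarrow> Some z)"
  by (simp add: T_mult_def L_pair_def K_pair_def fun_eq_iff)

lemma is_band_W_mult:
  assumes assoc: "\<And>s t u. m (m s t) u = m s (m t u)"
    and L: "\<And>s t. s \<in> L \<Longrightarrow> t \<in> L \<Longrightarrow> m s t \<in> L"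
    and K: "\<And>s t. s \<in> L \<Longrightarrow> t \<in> K \<Longrightarrow> m s t \<in> K" "\<And>s t. s \<in> L \<Longrightarrow> t \<in> K \<Longrightarrow> m t s \<in> K"
      "\<And>s t. s \<in> K \<Longrightarrow> t \<in> K \<Longrightarrow> m s t \<in> K"
    and idem: "\<And>s. s \<in> L \<Longrightarrow> m s s = s" "\<And>s. s \<in> K \<Longrightarrow> m s s = s"
  shows "is_band \<lparr>carrier = Base ` L \<union> Copy1 ` K \<union> Copy2 ` K \<union> {Zero}, smult = W_mult m\<rparr>"
proof -
  have "W_mult m (W_mult m s t) u = W_mult m s (W_mult m t u)" for s t u
    by (cases s; cases t; cases u) (simp_all add: assoc)
  then show ?thesis
    by (auto simp: is_band_def idempotents_def image_iff L K idem)
qed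

lemma is_band_B_GH: "is_band (B_GH R B)"
proof -
  note T = T_mult_K_K T_mult_L_L T_mult_L_K T_mult_K_L
  have L_H: "(\<exists>x y z. s = L_pair x y z) \<or>
      (\<exists>a. \<exists>b\<in>insert None (Some ` B). s = K_pair (Inl a) (Some b))"
    if "s \<in> L_G R \<union> K_H B" for s
    using that by (auto simp: L_G_def K_H_def)
  have "T_mult (T_mult s t) u = T_mult s (T_mult t u)" for s t u :: "'a T"
    by (simp add: T_mult_def o_assoc)
  moreover have "T_mult s t \<in> L_G R \<union> K_H B"
    if st: "s \<in> L_G R \<union> K_H B" "t \<in> L_G R \<union> K_H B" for s t
  proof -
    have K: "K_pair (Inl a) (Some b) \<in> K_H B" if "b \<in> insert None (Some ` B)" for a b
      unfolding K_H_def using that by blast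
    have "T_mult s t = s \<or> T_mult s t \<in> K_H B"
      using L_H[OF st(1)] L_H[OF st(2)]
      by (elim disjE exE bexE) (simp_all only: T sum.case option.case K simp_thms)
    with st(1) show ?thesis by auto
  qed
  moreover have "T_mult s t \<in> K_G" "T_mult t s \<in> K_G" if "s \<in> L_G R \<union> K_H B" "t \<in> K_G" for s t
    using L_H[OF that(1)] that(2) unfolding K_G_def
    by (elim disjE exE bexE CollectE conjE; simp only: T; blast)+
  moreover have "T_mult s t \<in> K_G" if "s \<in> K_G" "t \<in> K_G" for s t
    using that unfolding K_G_def by (elim CollectE exE conjE; simp only: T; blast)
  moreover have "T_mult s s = s" if "s \<in> L_G R \<union> K_H B" for s
    using L_H[OF that] by (auto simp: T)
  moreover have "T_mult s s = s" if "s \<in> K_G" for s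
    using that by (auto simp: T K_G_def)
  ultimately show ?thesis
    unfolding B_GH_def by (intro is_band_W_mult)
qed

end

theory Submission
  imports Defs
begin

text \<open>Inside \<open>IG\<close>, the defining relations contract two letters of one copy of
  \<open>K_G\<close> directly only if they share a row or a column; other products may carry a group
  element. The letter \<open>L_pair x y z\<close> makes rows x, y-bar and columns \<infinity>, z a
  singular square. With the sandwich matrix normalised to be trivial in row 1 and column 1, that
  square says zx = y. For \<open>L_pair None a a\<close> this reads a1 = a and for
  \<open>L_pair a a None\<close> it reads 1a = a: these two families make the generators in column
  \<infinity> agree with those in the other columns. Only the letters coming from \<open>R\<close>
  impose a group relation. Equalities are derived by inserting a letter that a neighbour absorbs and
  letting it act on the other neighbour. Inequalities come from automata reading the letters: it
  suffices that every basic pair acts like its product. At the border the right invariant is a left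
  coset of H. A letter of \<open>K_H\<close> read just before the second copy is entered changes the
  group element by a right factor from H, a letter of \<open>L_G\<close> by nothing.\<close>

text \<open>
  The letters of either copy of \<open>K\<^sub>G\<close> generate a Rees matrix semigroup over \<open>G\<close> inside
  \<open>IG\<close>: the letters of \<open>L\<^sub>G\<close> act on both sides and force the relations \<open>ab = c\<close>. Conversely, \<open>IG\<close>
  acts on \<open>G \<times> J\<close>, which shows that nothing more collapses. The number of alternations between the
  two copies is an invariant of non-zero words, so no idempotent mixes the copies; letters outside
  the copies and the zero only contribute trivial subgroups.

  At a border between the copies, letters of \<open>K\<^sub>H\<close> and \<open>L\<^sub>G\<close> may be absorbed on either side. This
  moves exactly the elements of \<open>H\<close> across the border. So \<open>g\<close> in the first copy followed by the
  identity of the second equals the identity of the first copy followed by \<open>g\<close> in the second if and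
  only if \<open>g \<in> H\<close>. These words are computable from a group word for \<open>g\<close>, hence a solution of the
  word problem of \<open>IG\<close> would decide membership in \<open>H\<close>.
\<close>

section \<open>Computable functions\<close>

text \<open>\<open>recursive_fn\<close> fixes a function on lists of every length, although its
  values off length \<open>n\<close> are accidental. Comparing on lists of length \<open>n\<close>
  only makes the closure properties below independent of these values.\<close>

definition computable :: "nat \<Rightarrow> (nat list \<Rightarrow> nat) \<Rightarrow> bool" where
  "computable n f \<longleftrightarrow> (\<exists>f'. recursive_fn n f' \<and> (\<forall>xs. length xs = n \<longrightarrow> f' xs = f xs))"

lemma computable_cong:
  "computable n f \<Longrightarrow> (\<And>xs. length xs = n \<Longrightarrow> f xs = g xs) \<Longrightarrow> computable n g"
  unfolding computable_def by metis

lemma computable_recursive_fn: "recursive_fn n f \<Longrightarrow> computable n f"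
  unfolding computable_def by blast

lemma computable_proj: "i < n \<Longrightarrow> computable n (\<lambda>xs. xs ! i)"
  by (intro computable_recursive_fn recursive_fn.proj)

lemma computable_comp:
  assumes f: "computable (length gs) f" and gs: "\<And>g. g \<in> set gs \<Longrightarrow> computable n g"
  shows "computable n (\<lambda>xs. f (map (\<lambda>g. g xs) gs))"
proof -
  obtain f' where f': "recursive_fn (length gs) f'" "\<And>xs. length xs = length gs \<Longrightarrow> f' xs = f xs"
    using f unfolding computable_def by blast
  obtain h where h: "\<And>g. g \<in> set gs \<Longrightarrow> recursive_fn n (h g) \<and> (\<forall>xs. length xs = n \<longrightarrow> h g xs = g xs)"
    using gs unfolding computable_def by metis
  have "recursive_fn n (\<lambda>xs. f' (map (\<lambda>g. g xs) (map h gs)))"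
    by (rule recursive_fn.comp) (use f' h in auto)
  then have "computable n (\<lambda>xs. f' (map (\<lambda>g. g xs) (map h gs)))"
    by (rule computable_recursive_fn)
  then show ?thesis
  proof (rule computable_cong)
    fix xs :: "nat list" assume "length xs = n"
    then have "map (\<lambda>g. g xs) (map h gs) = map (\<lambda>g. g xs) gs"
      using h by auto
    then show "f' (map (\<lambda>g. g xs) (map h gs)) = f (map (\<lambda>g. g xs) gs)"
      using f'(2) by (metis length_map)
  qed
qed

lemma computable_comp1:
  "computable 1 (\<lambda>xs. f (xs ! 0)) \<Longrightarrow> computable n g \<Longrightarrow> computable n (\<lambda>xs. f (g xs))"
  using computable_comp[of "[g]" "\<lambda>xs. f (xs ! 0)" n] by simp

lemma computable_comp2:
  "computable 2 (\<lambda>xs. f (xs ! 0) (xs ! 1)) \<Longrightarrow> computable n g \<Longrightarrow> computable n h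
    \<Longrightarrow> computable n (\<lambda>xs. f (g xs) (h xs))"
  using computable_comp[of "[g, h]" "\<lambda>xs. f (xs ! 0) (xs ! 1)" n]
  by (auto simp: numeral_2_eq_2)

lemma computable_Suc: "computable n f \<Longrightarrow> computable n (\<lambda>xs. Suc (f xs))"
  by (rule computable_comp1[OF computable_recursive_fn[OF recursive_fn.succ]])

lemma computable_const: "computable n (\<lambda>xs. k)"
  by (induction k) (auto intro: computable_recursive_fn recursive_fn.zero computable_Suc)

lemma computable_rec_nat:
  assumes f: "computable n f" and g: "computable (Suc (Suc n)) g" and m: "computable n m"
  shows "computable n (\<lambda>xs. rec_nat (f xs) (\<lambda>k y. g (k # y # xs)) (m xs))"
proof -
  obtain f' where f': "recursive_fn n f'" "\<And>xs. length xs = n \<Longrightarrow> f' xs = f xs"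
    using f unfolding computable_def by blast
  obtain g' where g': "recursive_fn (Suc (Suc n)) g'"
    "\<And>xs. length xs = Suc (Suc n) \<Longrightarrow> g' xs = g xs"
    using g unfolding computable_def by blast
  \<comment> \<open>\<open>prec\<close> recurses on the head of its argument list. Putting
    \<open>m\<close> in front of the projections makes the number of steps an arbitrary computable
    function and keeps all parameters.\<close>
  let ?gs = "m # map (\<lambda>i xs. xs ! i) [0..<n]"
  have "computable (length ?gs) (\<lambda>xs. rec_nat (f' (tl xs)) (\<lambda>k y. g' (k # y # tl xs)) (hd xs))"
    using recursive_fn.prec[OF f'(1) g'(1)] by (simp add: computable_recursive_fn)
  then have "computable n (\<lambda>xs. (\<lambda>xs. rec_nat (f' (tl xs)) (\<lambda>k y. g' (k # y # tl xs)) (hd xs))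
      (map (\<lambda>g. g xs) ?gs))"
    by (rule computable_comp) (auto intro: m computable_proj)
  then show ?thesis
  proof (rule computable_cong)
    fix xs :: "nat list" assume xs: "length xs = n"
    then have "map (\<lambda>g. g xs) (map (\<lambda>i xs. xs ! i) [0..<n]) = xs"
      by (intro nth_equalityI) auto
    with xs show "(\<lambda>xs. rec_nat (f' (tl xs)) (\<lambda>k y. g' (k # y # tl xs)) (hd xs))
      (map (\<lambda>g. g xs) ?gs) = rec_nat (f xs) (\<lambda>k y. g (k # y # xs)) (m xs)"
      by (simp add: f'(2) g'(2))
  qed
qed

lemma computable_funpow:
  assumes s: "computable 1 (\<lambda>xs. s (xs ! 0))" and "computable n m" "computable n f"
  shows "computable n (\<lambda>xs. (s ^^ m xs) (f xs))"
proof -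
  have "computable (Suc (Suc n)) (\<lambda>xs. s (xs ! 1))"
    by (rule computable_comp1[OF s computable_proj]) simp
  then have "computable n (\<lambda>xs. rec_nat (f xs) (\<lambda>k y. s ((k # y # xs) ! 1)) (m xs))"
    using assms by (intro computable_rec_nat)
  moreover have "rec_nat x (\<lambda>k y. s ((k # y # xs) ! 1)) j = (s ^^ j) x" for x j xs
    by (induction j) auto
  ultimately show ?thesis by simp
qed

lemma computable_add:
  assumes "computable n f" "computable n g" shows "computable n (\<lambda>xs. f xs + g xs)"
proof -
  have "computable n (\<lambda>xs. (Suc ^^ f xs) (g xs))"
    using assms by (intro computable_funpow computable_Suc computable_proj) simp_all
  moreover have "(Suc ^^ j) x = j + x" for j x by (induction j) auto
  ultimately show ?thesis by simp
qed

lemma computable_pred: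
  assumes "computable n f" shows "computable n (\<lambda>xs. f xs - 1)"
proof -
  have "computable n (\<lambda>xs. rec_nat 0 (\<lambda>k y. (k # y # xs) ! 0) (f xs))"
    using assms by (intro computable_rec_nat computable_const computable_proj) simp_all
  moreover have "rec_nat 0 (\<lambda>k y. (k # y # xs) ! 0) j = j - 1" for j :: nat and xs
    by (induction j) auto
  ultimately show ?thesis by simp
qed

lemma computable_diff:
  assumes "computable n f" "computable n g" shows "computable n (\<lambda>xs. f xs - g xs)"
proof -
  have "computable n (\<lambda>xs. ((\<lambda>x. x - 1) ^^ g xs) (f xs))"
    using assms by (intro computable_funpow computable_pred computable_proj) simp_all
  moreover have "((\<lambda>x. x - 1) ^^ j) x = x - j" for j x :: nat by (induction j) auto
  ultimately show ?thesis by simp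
qed

lemma computable_if_eq_0:
  assumes "computable n c" "computable n f" "computable n g"
  shows "computable n (\<lambda>xs. if c xs = 0 then f xs else g xs)"
proof -
  \<comment> \<open>A recursion that ignores counter and previous value returns \<open>g\<close>
    after any positive number of steps. The projections shifted by two drop these two
    arguments.\<close>
  have "computable (Suc (Suc n)) (\<lambda>xs. g (map (\<lambda>h. h xs) (map (\<lambda>i xs. xs ! Suc (Suc i)) [0..<n])))"
    using assms(3) by (intro computable_comp) (auto intro: computable_proj)
  then have "computable n (\<lambda>xs. rec_nat (f xs) (\<lambda>k y.
      g (map (\<lambda>h. h (k # y # xs)) (map (\<lambda>i xs. xs ! Suc (Suc i)) [0..<n]))) (c xs))"
    using assms by (intro computable_rec_nat)
  then show ?thesis
  proof (rule computable_cong)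
    fix xs :: "nat list" assume xs: "length xs = n"
    have "map (\<lambda>h. h (k # y # xs)) (map (\<lambda>i xs. xs ! Suc (Suc i)) [0..<n]) = xs" for k y
      using xs by (intro nth_equalityI) auto
    then show "rec_nat (f xs) (\<lambda>k y.
      g (map (\<lambda>h. h (k # y # xs)) (map (\<lambda>i xs. xs ! Suc (Suc i)) [0..<n]))) (c xs)
      = (if c xs = 0 then f xs else g xs)"
      by (cases "c xs") simp_all
  qed
qed

lemma computable_if_eq:
  assumes "computable n c" "computable n f" "computable n g"
  shows "computable n (\<lambda>xs. if c xs = k then f xs else g xs)"
proof -
  have "computable n (\<lambda>xs. if (c xs - k) + (k - c xs) = 0 then f xs else g xs)"
    using assms by (intro computable_if_eq_0 computable_add computable_diff computable_const)
  moreover have "(x - k) + (k - x) = 0 \<longleftrightarrow> x = k" for x :: nat by auto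
  ultimately show ?thesis by simp
qed

lemma computable_triangle:
  assumes "computable n f" shows "computable n (\<lambda>xs. triangle (f xs))"
proof -
  have "computable n (\<lambda>xs. rec_nat 0 (\<lambda>k y. (k # y # xs) ! 1 + Suc ((k # y # xs) ! 0)) (f xs))"
    using assms
    by (intro computable_rec_nat computable_const computable_add computable_Suc computable_proj) simp_all
  moreover have "rec_nat 0 (\<lambda>k y. (k # y # xs) ! 1 + Suc ((k # y # xs) ! 0)) j = triangle j" for j xs
    by (induction j) auto
  ultimately show ?thesis by simp
qed

lemma computable_prod_encode:
  assumes "computable n f" "computable n g" shows "computable n (\<lambda>xs. prod_encode (f xs, g xs))"
  unfolding prod_encode_def split_conv
  using assms by (intro computable_add computable_triangle)

section \<open>Minimisation and decoding of pairs\<close>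

lemma computable_Least:
  assumes f: "computable (Suc n) f" and reg: "\<And>xs. length xs = n \<Longrightarrow> \<exists>k. f (k # xs) = 0"
  shows "computable n (\<lambda>xs. LEAST k. f (k # xs) = 0)"
proof -
  obtain f' where f': "recursive_fn (Suc n) f'" "\<And>xs. length xs = Suc n \<Longrightarrow> f' xs = f xs"
    using f unfolding computable_def by blast
  have "recursive_fn n (\<lambda>xs. LEAST k. f' (k # xs) = 0)"
    by (rule recursive_fn.minim[OF f'(1)]) (use f'(2) reg in simp)
  then show ?thesis
    by (rule computable_cong[OF computable_recursive_fn]) (simp add: f'(2))
qed

text \<open>\<open>prod_encode (x, y)\<close> is \<open>triangle (x + y) + x\<close>, so
  \<open>x + y\<close> is the least \<open>s\<close> for which the code lies below
  \<open>triangle (Suc s)\<close>. Truncated subtraction turns this inequality into the test for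
  zero that minimisation needs.\<close>

definition antidiagonal :: "nat \<Rightarrow> nat" where
  "antidiagonal z = (LEAST s. Suc z - triangle (Suc s) = 0)"

lemma le_triangle: "n \<le> triangle n"
  by (induction n) auto

lemma triangle_mono: "m \<le> n \<Longrightarrow> triangle m \<le> triangle n"
  by (induction n) (auto simp: le_Suc_eq)

lemma antidiagonal_prod_encode: "antidiagonal (prod_encode (x, y)) = x + y"
  unfolding antidiagonal_def
proof (rule Least_equality)
  fix s assume "Suc (prod_encode (x, y)) - triangle (Suc s) = 0"
  then have less: "triangle (x + y) + x < triangle (Suc s)"
    by (simp add: prod_encode_def)
  show "x + y \<le> s"
  proof (rule ccontr)
    assume "\<not> x + y \<le> s"
    then have "triangle (Suc s) \<le> triangle (x + y)" by (intro triangle_mono) simp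
    with less show False by simp
  qed
qed (simp add: prod_encode_def)

lemma computable_antidiagonal:
  assumes "computable n f" shows "computable n (\<lambda>xs. antidiagonal (f xs))"
proof (rule computable_comp1[OF _ assms])
  have "computable 1 (\<lambda>xs. LEAST s. (\<lambda>xs. Suc (xs ! 1) - triangle (Suc (xs ! 0))) (s # xs) = 0)"
  proof (rule computable_Least)
    show "computable (Suc 1) (\<lambda>xs. Suc (xs ! 1) - triangle (Suc (xs ! 0)))"
      by (intro computable_diff computable_triangle computable_Suc computable_proj) simp_all
    show "\<exists>k. Suc ((k # xs) ! 1) - triangle (Suc ((k # xs) ! 0)) = 0" if "length xs = 1" for xs
      using le_triangle[of "xs ! 0"] by (auto intro!: exI[of _ "xs ! 0"])
  qed
  then show "computable 1 (\<lambda>xs. antidiagonal (xs ! 0))"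
    by (simp add: antidiagonal_def)
qed

lemma fst_prod_decode: "fst (prod_decode z) = z - triangle (antidiagonal z)"
proof -
  obtain x y where "z = prod_encode (x, y)" by (metis prod_decode_inverse surj_pair)
  then show ?thesis using antidiagonal_prod_encode[of x y] by (simp, simp add: prod_encode_def)
qed

lemma snd_prod_decode: "snd (prod_decode z) = antidiagonal z - (z - triangle (antidiagonal z))"
proof -
  obtain x y where "z = prod_encode (x, y)" by (metis prod_decode_inverse surj_pair)
  then show ?thesis using antidiagonal_prod_encode[of x y] by (simp, simp add: prod_encode_def)
qed

lemma computable_fst_decode:
  "computable n f \<Longrightarrow> computable n (\<lambda>xs. fst (prod_decode (f xs)))"
  unfolding fst_prod_decode
  by (intro computable_diff computable_triangle computable_antidiagonal)

lemma computable_snd_decode: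
  "computable n f \<Longrightarrow> computable n (\<lambda>xs. snd (prod_decode (f xs)))"
  unfolding snd_prod_decode
  by (intro computable_diff computable_triangle computable_antidiagonal)

text \<open>One round of a loop on pairs of list code and accumulator. Code \<open>0\<close> is the
  empty list; a positive code holds head and tail in its predecessor. On code \<open>0\<close> the
  loop stands still, so surplus rounds do no harm.\<close>

definition fold_step :: "(nat \<Rightarrow> nat \<Rightarrow> nat) \<Rightarrow> nat \<Rightarrow> nat" where
  "fold_step D s =
     (if fst (prod_decode s) = 0 then s
      else prod_encode (snd (prod_decode (fst (prod_decode s) - 1)),
             D (fst (prod_decode (fst (prod_decode s) - 1))) (snd (prod_decode s))))"

lemma funpow_fold_step:
  "length xs \<le> k \<Longrightarrow>
    (fold_step D ^^ k) (prod_encode (list_encode xs, u)) = prod_encode (0, fold D xs u)"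
proof (induction k arbitrary: xs u)
  case (Suc k)
  show ?case
  proof (cases xs)
    case Nil
    then have "fold_step D (prod_encode (list_encode xs, u)) = prod_encode (list_encode [], u)"
      by (simp add: fold_step_def)
    then show ?thesis using Suc.IH[of "[]" u] Nil
      by (simp add: funpow_Suc_right del: funpow.simps)
  next
    case (Cons y ys)
    then have "fold_step D (prod_encode (list_encode xs, u)) = prod_encode (list_encode ys, D y u)"
      by (simp add: fold_step_def)
    then show ?thesis using Suc.IH[of ys "D y u"] Suc.prems Cons
      by (simp add: funpow_Suc_right del: funpow.simps)
  qed
qed auto

lemma le_prod_encode2: "y \<le> prod_encode (x, y)"
  using le_triangle[of "x + y"] by (simp add: prod_encode_def)

lemma length_le_list_encode: "length xs \<le> list_encode xs"
proof (induction xs)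
  case (Cons x xs)
  then show ?case using le_prod_encode2[of "list_encode xs" x] by simp
qed simp

text \<open>A list code bounds the length of its list and can itself serve as the number of
  rounds.\<close>

lemma computable_fold:
  assumes D: "computable 2 (\<lambda>xs. D (xs ! 0) (xs ! 1))" and f: "computable n f" and u: "computable n u"
  shows "computable n (\<lambda>xs. fold D (list_decode (f xs)) (u xs))"
proof -
  have "computable 1 (\<lambda>xs. fold_step D (xs ! 0))"
    unfolding fold_step_def
    by (intro computable_if_eq_0 computable_prod_encode computable_comp2[OF D]
        computable_fst_decode computable_snd_decode computable_pred computable_proj) simp_all
  then have "computable n (\<lambda>xs. snd (prod_decode ((fold_step D ^^ f xs) (prod_encode (f xs, u xs)))))"
    using f u by (intro computable_snd_decode computable_funpow computable_prod_encode)
  moreover have "(fold_step D ^^ m) (prod_encode (m, x)) = prod_encode (0, fold D (list_decode m) x)"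
    for m x
    using funpow_fold_step[of "list_decode m" m D x] length_le_list_encode[of "list_decode m"] by simp
  ultimately show ?thesis by simp
qed

section \<open>Substitution on coded words\<close>

lemma computable_prepend:
  "computable n f \<Longrightarrow> computable n (\<lambda>xs. list_encode (ys @ list_decode (f xs)))"
  by (induction ys) (simp_all add: computable_Suc computable_prod_encode computable_const
      del: One_nat_def)

text \<open>\<open>t\<close> is an arbitrary function; computability comes from there being only
  finitely many cases below \<open>N\<close>, split off one at a time.\<close>

lemma computable_prepend_table:
  "computable 2 (\<lambda>xs. list_encode ((if xs ! 0 < N then t (xs ! 0) else q) @ list_decode (xs ! 1)))"
proof (induction N)
  case 0
  show ?case by (simp, intro computable_prepend computable_proj) simp
next
  case (Suc N)
  have "computable 2 (\<lambda>xs. if xs ! 0 = N then list_encode (t N @ list_decode (xs ! 1))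
    else list_encode ((if xs ! 0 < N then t (xs ! 0) else q) @ list_decode (xs ! 1)))"
    by (intro computable_if_eq Suc.IH computable_prepend computable_proj) simp_all
  then show ?case
    by (rule computable_cong) (auto simp: less_Suc_eq)
qed

text \<open>Letters from \<open>N\<close> on are all sent to \<open>q\<close>, so that codes of non-words can be recognised.\<close>

lemma computable_reverse_substitution:
  assumes f: "computable n f"
  shows "computable n (\<lambda>xs. list_encode
    (concat (map (\<lambda>x. if x < N then t x else q) (rev (list_decode (f xs)))) @ ys))"
proof -
  let ?s = "\<lambda>x. if x < N then t x else q"
  let ?D = "\<lambda>x u. list_encode (?s x @ list_decode u)"
  \<comment> \<open>Each step prepends, so the images of the letters come out in reverse
    order.\<close>
  have "fold ?D xs (list_encode ys) = list_encode (concat (map ?s (rev xs)) @ ys)" for xs ys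
    by (induction xs arbitrary: ys) simp_all
  moreover have "computable n (\<lambda>xs. fold ?D (list_decode (f xs)) (list_encode ys))"
    by (intro computable_fold computable_prepend_table f computable_const)
  ultimately show ?thesis by simp
qed

lemma recursive_set_if_computable:
  assumes "computable 1 (\<lambda>xs. if xs ! 0 \<in> S then 1 else 0)" shows "recursive_set S"
proof -
  obtain f where "recursive_fn 1 f" "\<forall>xs. length xs = 1 \<longrightarrow> f xs = (if xs ! 0 \<in> S then 1 else 0)"
    using assms unfolding computable_def by blast
  then show ?thesis unfolding recursive_set_def by (auto intro!: exI[of _ f])
qed

lemma recursive_set_vimage:
  assumes S: "recursive_set S" and g: "computable 1 (\<lambda>xs. g (xs ! 0))" and S': "\<And>x. x \<in> S' \<longleftrightarrow> g x \<in> S"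
  shows "recursive_set S'"
proof -
  obtain f where f: "recursive_fn 1 f" "\<And>x. f [x] = (if x \<in> S then 1 else 0)"
    using S unfolding recursive_set_def by blast
  have "computable 1 (\<lambda>xs. f [xs ! 0])"
    by (rule computable_cong[OF computable_recursive_fn[OF f(1)]]) (auto simp: length_Suc_conv)
  then have "computable 1 (\<lambda>xs. f [g (xs ! 0)])"
    by (rule computable_comp1[OF _ g])
  then show ?thesis
    by (intro recursive_set_if_computable) (simp add: f(2) S')
qed

lemma recursive_set_singleton: "recursive_set {k}"
proof (rule recursive_set_if_computable)
  have "computable 1 (\<lambda>xs. if xs ! 0 = k then 1 else 0)"
    by (intro computable_if_eq computable_const computable_proj) simp
  then show "computable 1 (\<lambda>xs. if xs ! 0 \<in> {k} then 1 else 0)" by simp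
qed


section \<open>Words representing elements of \<open>IG\<close>\<close>

lemma pres_cong_lists: "pres_cong X Q u v \<Longrightarrow> u \<in> lists X \<and> v \<in> lists X"
  by (induction rule: pres_cong.induct) auto

text \<open>Letters acting on states, with both sides of each relation acting alike, yield an
  invariant of the congruence. Restricting to a closed set \<open>S\<close> of states allows the
  relations to hold only for well-formed states.\<close>

lemma pres_cong_fold:
  assumes "pres_cong X Q u v"
    and rel: "\<And>u v s. (u, v) \<in> Q \<Longrightarrow> u \<in> lists X \<Longrightarrow> v \<in> lists X \<Longrightarrow> s \<in> S \<Longrightarrow> fold f u s = fold f v s"
    and closed: "\<And>x s. x \<in> X \<Longrightarrow> s \<in> S \<Longrightarrow> f x s \<in> S"
    and "s \<in> S"
  shows "fold f u s = fold f v s"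
proof -
  have closed': "fold f w s \<in> S" if "w \<in> lists X" "s \<in> S" for w s
    using that by (induction w arbitrary: s) (auto simp: closed)
  show ?thesis
    using assms(1) \<open>s \<in> S\<close>
  proof (induction arbitrary: s rule: pres_cong.induct)
    case (mult u v u' v')
    then show ?case using closed' pres_cong_lists[OF mult.hyps(1)] by simp
  qed (auto simp: rel)
qed

lemma IG_class_eq_iff:
  assumes "u \<in> lists (carrier \<E>)"
  shows "IG_class \<E> u = IG_class \<E> v \<longleftrightarrow> pres_cong (carrier \<E>) (IG_relations \<E>) u v"
proof
  assume "IG_class \<E> u = IG_class \<E> v"
  moreover have "u \<in> IG_class \<E> u"
    by (simp add: IG_class_def pres_cong.refl assms)
  ultimately show "pres_cong (carrier \<E>) (IG_relations \<E>) u v"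
    by (simp add: IG_class_def pres_cong.sym)
next
  assume "pres_cong (carrier \<E>) (IG_relations \<E>) u v"
  then show "IG_class \<E> u = IG_class \<E> v"
    unfolding IG_class_def by (blast intro: pres_cong.sym pres_cong.trans)
qed

lemma IG_class_eq_empty: "u \<notin> lists (carrier \<E>) \<Longrightarrow> IG_class \<E> u = {}"
  unfolding IG_class_def using pres_cong_lists by fast

text \<open>A word with a foreign letter has the empty class, and then both sides are empty; hence
  no side condition is required for rewriting.\<close>

lemma IG_mult_class: "IG_class \<E> u \<odot>\<^bsub>IG \<E>\<^esub> IG_class \<E> v = IG_class \<E> (u @ v)"
proof (cases "u \<in> lists (carrier \<E>) \<and> v \<in> lists (carrier \<E>)")
  case True
  have "IG_class \<E> (u' @ v') = IG_class \<E> (u @ v)" if "u' \<in> IG_class \<E> u" "v' \<in> IG_class \<E> v" for u' v'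
  proof -
    have "pres_cong (carrier \<E>) (IG_relations \<E>) (u @ v) (u' @ v')"
      using that by (simp add: IG_class_def pres_cong.mult)
    moreover have "u @ v \<in> lists (carrier \<E>)" using True by simp
    ultimately show ?thesis using IG_class_eq_iff[of "u @ v"] by metis
  qed
  moreover have "u \<in> IG_class \<E> u" "v \<in> IG_class \<E> v"
    using True by (simp_all add: IG_class_def pres_cong.refl)
  moreover have "IG_class \<E> u \<odot>\<^bsub>IG \<E>\<^esub> IG_class \<E> v =
      (\<Union>u'\<in>IG_class \<E> u. \<Union>v'\<in>IG_class \<E> v. IG_class \<E> (u' @ v'))"
    by (simp add: IG_def)
  ultimately show ?thesis
    by blast
next
  case False
  then have "IG_class \<E> u = {} \<or> IG_class \<E> v = {}" "u @ v \<notin> lists (carrier \<E>)"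
    using IG_class_eq_empty by (metis, simp only: append_in_lists_conv simp_thms)
  then show ?thesis by (elim disjE) (simp_all add: IG_def IG_class_eq_empty)
qed

lemma IG_class_append_cong:
  "u' \<in> IG_class \<E> u \<Longrightarrow> IG_class \<E> (u' @ v) = IG_class \<E> (u @ v)"
  "v' \<in> IG_class \<E> v \<Longrightarrow> IG_class \<E> (u @ v') = IG_class \<E> (u @ v)"
proof -
  have eq: "IG_class \<E> u' = IG_class \<E> u" if "u' \<in> IG_class \<E> u" for u u'
    using that unfolding IG_class_def by (blast intro: pres_cong.sym pres_cong.trans)
  show "IG_class \<E> (u' @ v) = IG_class \<E> (u @ v)" if "u' \<in> IG_class \<E> u"
    using eq[OF that] by (metis IG_mult_class)
  show "IG_class \<E> (u @ v') = IG_class \<E> (u @ v)" if "v' \<in> IG_class \<E> v"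
    using eq[OF that] by (metis IG_mult_class)
qed

lemma UN_IG_class_append:
  "(\<Union>w \<in> IG_class \<E> u. IG_class \<E> (w @ v)) = IG_class \<E> (u @ v)"
  "(\<Union>w \<in> IG_class \<E> v. IG_class \<E> (u @ w)) = IG_class \<E> (u @ v)"
proof -
  have empty: "IG_class \<E> u = {} \<Longrightarrow> IG_class \<E> (u @ v) = {}"
    "IG_class \<E> v = {} \<Longrightarrow> IG_class \<E> (u @ v) = {}"
    unfolding IG_mult_class[symmetric] by (simp_all add: IG_def)
  show "(\<Union>w \<in> IG_class \<E> u. IG_class \<E> (w @ v)) = IG_class \<E> (u @ v)"
    using empty(1) by (cases "IG_class \<E> u = {}") (simp_all add: IG_class_append_cong)
  show "(\<Union>w \<in> IG_class \<E> v. IG_class \<E> (u @ w)) = IG_class \<E> (u @ v)"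
    using empty(2) by (cases "IG_class \<E> v = {}") (simp_all add: IG_class_append_cong)
qed

text \<open>The product of \<open>IG\<close> is defined on all sets of words and is associative
  there, so brackets can be moved without membership proofs.\<close>

lemma IG_mult_assoc: "(C \<odot>\<^bsub>IG \<E>\<^esub> D) \<odot>\<^bsub>IG \<E>\<^esub> F = C \<odot>\<^bsub>IG \<E>\<^esub> (D \<odot>\<^bsub>IG \<E>\<^esub> F)"
proof -
  have mult: "C \<odot>\<^bsub>IG \<E>\<^esub> D = (\<Union>u\<in>C. \<Union>v\<in>D. IG_class \<E> (u @ v))" for C D
    by (simp add: IG_def)
  have "(C \<odot>\<^bsub>IG \<E>\<^esub> D) \<odot>\<^bsub>IG \<E>\<^esub> F =
      (\<Union>u\<in>C. \<Union>v\<in>D. \<Union>x\<in>F. \<Union>w\<in>IG_class \<E> (u @ v). IG_class \<E> (w @ x))"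
    unfolding mult by blast
  also have "\<dots> = (\<Union>u\<in>C. \<Union>v\<in>D. \<Union>x\<in>F. \<Union>w\<in>IG_class \<E> (v @ x). IG_class \<E> (u @ w))"
    unfolding UN_IG_class_append by simp
  also have "\<dots> = C \<odot>\<^bsub>IG \<E>\<^esub> (D \<odot>\<^bsub>IG \<E>\<^esub> F)"
    unfolding mult by blast
  finally show ?thesis .
qed

text \<open>An idempotent is a left identity on its \<R>-class and a right identity on its
  \<L>-class; the two divisibility conditions give the reverse inclusions of ideals.\<close>

lemma IG_idempotent_H_class:
  assumes x: "x \<in> idempotents (IG \<E>)" and y: "y \<in> carrier (IG \<E>)"
  shows "y \<in> H_class (IG \<E>) x \<longleftrightarrow>
    x \<odot>\<^bsub>IG \<E>\<^esub> y = y \<and> y \<odot>\<^bsub>IG \<E>\<^esub> x = y \<and>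
    (\<exists>s\<in>carrier (IG \<E>). y \<odot>\<^bsub>IG \<E>\<^esub> s = x) \<and> (\<exists>s\<in>carrier (IG \<E>). s \<odot>\<^bsub>IG \<E>\<^esub> y = x)"
    (is "_ \<longleftrightarrow> ?r")
proof
  have xx: "x \<odot>\<^bsub>IG \<E>\<^esub> x = x" and xc: "x \<in> carrier (IG \<E>)"
    using x by (auto simp: idempotents_def)
  have closed: "s \<odot>\<^bsub>IG \<E>\<^esub> t \<in> carrier (IG \<E>)"
    if st: "s \<in> carrier (IG \<E>)" "t \<in> carrier (IG \<E>)" for s t
  proof -
    obtain u v where "s = IG_class \<E> u" "t = IG_class \<E> v" "u \<in> lists (carrier \<E>) - {[]}"
      "v \<in> lists (carrier \<E>) - {[]}"
      using st by (auto simp: IG_def)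
    then have "s \<odot>\<^bsub>IG \<E>\<^esub> t = IG_class \<E> (u @ v)" "u @ v \<in> lists (carrier \<E>) - {[]}"
      by (auto simp: IG_mult_class)
    then show ?thesis unfolding IG_def by auto
  qed
  {
    assume "y \<in> H_class (IG \<E>) x"
    then have r: "right_ideal (IG \<E>) x = right_ideal (IG \<E>) y"
      and l: "left_ideal (IG \<E>) x = left_ideal (IG \<E>) y"
      by (auto simp: H_class_def)
    have "y \<in> right_ideal (IG \<E>) x" "x \<in> right_ideal (IG \<E>) y"
      by (simp add: r, simp add: right_ideal_def) (simp add: r[symmetric], simp add: right_ideal_def)
    then have r': "y = x \<or> (\<exists>s\<in>carrier (IG \<E>). y = x \<odot>\<^bsub>IG \<E>\<^esub> s)" "x = y \<or> (\<exists>s\<in>carrier (IG \<E>). x = y \<odot>\<^bsub>IG \<E>\<^esub> s)"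
      unfolding right_ideal_def by blast+
    have "y \<in> left_ideal (IG \<E>) x" "x \<in> left_ideal (IG \<E>) y"
      by (simp add: l, simp add: left_ideal_def) (simp add: l[symmetric], simp add: left_ideal_def)
    then have l': "y = x \<or> (\<exists>s\<in>carrier (IG \<E>). y = s \<odot>\<^bsub>IG \<E>\<^esub> x)" "x = y \<or> (\<exists>s\<in>carrier (IG \<E>). x = s \<odot>\<^bsub>IG \<E>\<^esub> y)"
      unfolding left_ideal_def by blast+
    have "x \<odot>\<^bsub>IG \<E>\<^esub> y = y"
      using r'(1) xx by (metis IG_mult_assoc)
    moreover have "y \<odot>\<^bsub>IG \<E>\<^esub> x = y"
      using l'(1) xx by (metis IG_mult_assoc)
    ultimately show ?r
      using r'(2) l'(2) xc xx by metis
  }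
  assume ?r
  then obtain s t where st: "x \<odot>\<^bsub>IG \<E>\<^esub> y = y" "y \<odot>\<^bsub>IG \<E>\<^esub> x = y" "s \<in> carrier (IG \<E>)"
    "y \<odot>\<^bsub>IG \<E>\<^esub> s = x" "t \<in> carrier (IG \<E>)" "t \<odot>\<^bsub>IG \<E>\<^esub> y = x"
    by blast
  have "x \<odot>\<^bsub>IG \<E>\<^esub> z = y \<odot>\<^bsub>IG \<E>\<^esub> (s \<odot>\<^bsub>IG \<E>\<^esub> z)" "z \<odot>\<^bsub>IG \<E>\<^esub> x = (z \<odot>\<^bsub>IG \<E>\<^esub> t) \<odot>\<^bsub>IG \<E>\<^esub> y" "y \<odot>\<^bsub>IG \<E>\<^esub> z = x \<odot>\<^bsub>IG \<E>\<^esub> (y \<odot>\<^bsub>IG \<E>\<^esub> z)" "z \<odot>\<^bsub>IG \<E>\<^esub> y = (z \<odot>\<^bsub>IG \<E>\<^esub> y) \<odot>\<^bsub>IG \<E>\<^esub> x" for z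
    using st by (metis IG_mult_assoc)+
  then have "right_ideal (IG \<E>) x = right_ideal (IG \<E>) y" "left_ideal (IG \<E>) x = left_ideal (IG \<E>) y"
    unfolding right_ideal_def left_ideal_def using st xc y closed by (auto simp: image_iff) metis+
  then show "y \<in> H_class (IG \<E>) x"
    using y unfolding H_class_def by auto
qed

lemma IG_fold:
  assumes "IG_class (biordered_set S) u = IG_class (biordered_set S) v" "u \<in> lists (idempotents S)"
    and rel: "\<And>e f s. basic_pair S e f \<Longrightarrow> s \<in> Q \<Longrightarrow> g f (g e s) = g (e \<odot>\<^bsub>S\<^esub> f) s"
    and closed: "\<And>e s. e \<in> idempotents S \<Longrightarrow> s \<in> Q \<Longrightarrow> g e s \<in> Q"
    and "s \<in> Q"
  shows "fold g u s = fold g v s"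
proof (rule pres_cong_fold)
  show "pres_cong (carrier (biordered_set S)) (IG_relations (biordered_set S)) u v"
    using assms(1,2) IG_class_eq_iff[of u "biordered_set S" v] by (simp add: biordered_set_def)
  show "g x s \<in> Q" if "x \<in> carrier (biordered_set S)" "s \<in> Q" for x s
    using that closed by (simp add: biordered_set_def)
  show "fold g u s = fold g v s" if "(u, v) \<in> IG_relations (biordered_set S)" "s \<in> Q" for u v s
    using that rel by (auto simp: IG_relations_def biordered_set_def split: if_splits)
qed fact

text \<open>The automaton has two states and remembers whether a letter outside \<open>X\<close> has
  been read.\<close>

lemma IG_content:
  assumes "IG_class (biordered_set S) u = IG_class (biordered_set S) v" "u \<in> lists (idempotents S)"
    and "\<And>e f. basic_pair S e f \<Longrightarrow> e \<odot>\<^bsub>S\<^esub> f \<in> X \<longleftrightarrow> e \<in> X \<and> f \<in> X"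
  shows "set u \<subseteq> X \<longleftrightarrow> set v \<subseteq> X"
proof -
  have "fold (\<lambda>e s. s \<and> e \<in> X) u True = fold (\<lambda>e s. s \<and> e \<in> X) v True"
    by (rule IG_fold[where Q = UNIV]) (use assms in auto)
  moreover have "fold (\<lambda>e s. s \<and> e \<in> X) w s \<longleftrightarrow> s \<and> set w \<subseteq> X" for w s
    by (induction w arbitrary: s) auto
  ultimately show ?thesis by simp
qed


section \<open>The Rees matrix semigroups inside \<open>IG\<close>\<close>

text \<open>The three families of \<open>L_G\<close> as one. With \<open>None\<close> read as 1,
  each case is an instance of zx = y: z1 = z, 1x = x, or a relation ab = c.\<close>

definition L_data :: "('a \<times> 'a \<times> 'a) set \<Rightarrow> 'a A1 \<Rightarrow> 'a A1 \<Rightarrow> 'a A1 \<Rightarrow> bool" where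
  "L_data R x y z \<longleftrightarrow> x = None \<and> y = z \<or> x = y \<and> z = None \<or>
     (\<exists>a b c. (a, b, c) \<in> R \<and> x = Some b \<and> y = Some c \<and> z = Some a)"

lemma L_G_eq: "L_G R = {L_pair x y z | x y z. L_data R x y z}"
proof (intro equalityI subsetI)
  fix t assume "t \<in> L_G R"
  then show "t \<in> {L_pair x y z | x y z. L_data R x y z}"
    unfolding L_G_def L_data_def by blast
next
  fix t assume "t \<in> {L_pair x y z | x y z. L_data R x y z}"
  then show "t \<in> L_G R"
    unfolding L_G_def L_data_def by blast
qed

definition copy :: "bool \<Rightarrow> 's \<Rightarrow> 's W" where
  "copy p = (if p then Copy1 else Copy2)"

lemma W_mult_copy:
  "W_mult m (copy p s) (copy p t) = copy p (m s t)"
  "W_mult m (Base s) (copy p t) = copy p (m s t)"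
  "W_mult m (copy p s) (Base t) = copy p (m s t)"
  by (simp_all add: copy_def)

text \<open>A group word realised at row 1 and column 1. The idempotent in row 1-bar and column a
  carries the group element a, so (1,1)(1-bar,a)(1,1) represents a; the product (1,a)(1-bar,1) picks
  up the sandwich entry, which is the inverse of a. The leading letter represents the identity and
  keeps the word non-empty.\<close>

definition K_word :: "bool \<Rightarrow> ('a \<times> bool) list \<Rightarrow> 'a T W list" where
  "K_word p w = copy p (K_pair (Inl None) (Some None)) # concat (map (\<lambda>(a, e).
     if e then [copy p (K_pair (Inr None) (Some (Some a))), copy p (K_pair (Inl None) (Some None))]
     else [copy p (K_pair (Inl None) (Some (Some a))), copy p (K_pair (Inr None) (Some None))]) w)"

text \<open>The \<open>(j, i)\<close> entry of the sandwich matrix of the Rees matrix semigroup, as a group word.\<close>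

fun sandwich :: "'a J \<Rightarrow> 'a I \<Rightarrow> ('a \<times> bool) list" where
  "sandwich (Some (Some b)) (Inr _) = [(b, False)]"
| "sandwich None (Inl (Some a)) = [(a, False)]"
| "sandwich None (Inr (Some a)) = [(a, False)]"
| "sandwich _ _ = []"

locale IG_band =
  fixes R :: "('a \<times> 'a \<times> 'a) set" and B :: "'a set"
begin

abbreviation "\<E> \<equiv> biordered_set (B_GH R B)"
abbreviation mul (infixl "\<cdot>" 70) where "C \<cdot> D \<equiv> C \<odot>\<^bsub>IG \<E>\<^esub> D"
abbreviation "cl w \<equiv> IG_class \<E> w"
abbreviation "K p i j \<equiv> cl [copy p (K_pair i j)]"
abbreviation "KH a b \<equiv> cl [Base (K_pair (Inl a) (Some b))]"
abbreviation "L x y z \<equiv> cl [Base (L_pair x y z)]"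
abbreviation "B1 \<equiv> insert None (Some ` B)"

lemma carrier_E: "carrier \<E> = carrier (B_GH R B)" "idempotents (B_GH R B) = carrier (B_GH R B)"
  using is_band_B_GH[of R B] by (simp_all add: biordered_set_def is_band_def)

lemma in_carrier:
  "copy p (K_pair i j) \<in> carrier (B_GH R B)"
  "Zero \<in> carrier (B_GH R B)"
  "L_data R x y z \<Longrightarrow> Base (L_pair x y z) \<in> carrier (B_GH R B)"
  "b \<in> B1 \<Longrightarrow> Base (K_pair (Inl a) (Some b)) \<in> carrier (B_GH R B)"
proof -
  have "K_pair i j \<in> K_G" by (auto simp: K_G_def)
  then show "copy p (K_pair i j) \<in> carrier (B_GH R B)"
    by (simp add: B_GH_def copy_def)
  show "Zero \<in> carrier (B_GH R B)" by (simp add: B_GH_def)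
  show "Base (L_pair x y z) \<in> carrier (B_GH R B)" if "L_data R x y z"
  proof -
    have "L_pair x y z \<in> L_G R" using that by (auto simp: L_G_eq)
    then show ?thesis by (simp add: B_GH_def)
  qed
  show "Base (K_pair (Inl a) (Some b)) \<in> carrier (B_GH R B)" if "b \<in> B1"
  proof -
    have "K_pair (Inl a) (Some b) \<in> K_H B" unfolding K_H_def using that by blast
    then show ?thesis by (simp add: B_GH_def)
  qed
qed

lemma carrier_cases:
  assumes "e \<in> carrier (B_GH R B)"
  obtains (L) x y z where "L_data R x y z" "e = Base (L_pair x y z)"
  | (KH) a b where "b \<in> B1" "e = Base (K_pair (Inl a) (Some b))"
  | (K) p i j where "e = copy p (K_pair i j)"
  | (Zero) "e = W.Zero"
proof -
  consider t where "t \<in> L_G R" "e = Base t" | t where "t \<in> K_H B" "e = Base t"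
    | t where "t \<in> K_G" "e = Copy1 t" | t where "t \<in> K_G" "e = Copy2 t" | "e = W.Zero"
    using assms by (auto simp: B_GH_def)
  then show thesis
  proof cases
    case 1
    then obtain x y z where "L_data R x y z" "t = L_pair x y z" unfolding L_G_eq by blast
    then show thesis using L 1(2) by simp
  next
    case 2
    then obtain a b where "b \<in> B1" "t = K_pair (Inl a) (Some b)" unfolding K_H_def by blast
    then show thesis using KH 2(2) by simp
  next
    case 3
    then show thesis using K[of True] by (auto simp: K_G_def copy_def)
  next
    case 4
    then show thesis using K[of False] by (auto simp: K_G_def copy_def)
  next
    case 5
    then show thesis using Zero by simp
  qed
qed

lemma mul_basic:
  assumes "e \<in> carrier (B_GH R B)" "f \<in> carrier (B_GH R B)"
    and "W_mult T_mult e f = e \<or> W_mult T_mult e f = f \<or> W_mult T_mult f e = e \<or> W_mult T_mult f e = f"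
  shows "cl [e] \<cdot> cl [f] = cl [W_mult T_mult e f]"
proof -
  let ?S = "B_GH R B"
  have "basic_pair ?S e f"
    using assms unfolding basic_pair_def carrier_E by (auto simp: B_GH_def)
  then have "([e, f], [e \<odot>\<^bsub>?S\<^esub> f]) \<in> IG_relations \<E>"
    using assms unfolding IG_relations_def by (auto simp: biordered_set_def carrier_E)
  moreover have "e \<odot>\<^bsub>?S\<^esub> f \<in> carrier ?S"
    using is_band_B_GH[of R B] assms by (auto simp: is_band_def)
  ultimately have "pres_cong (carrier \<E>) (IG_relations \<E>) [e, f] [e \<odot>\<^bsub>?S\<^esub> f]"
    using assms by (intro pres_cong.rel) (auto simp: carrier_E)
  then have "cl [e, f] = cl [e \<odot>\<^bsub>?S\<^esub> f]"
    using assms by (subst IG_class_eq_iff) (auto simp: carrier_E)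
  then show ?thesis
    using IG_mult_class[of \<E> "[e]" "[f]"] by (simp add: B_GH_def)
qed

section \<open>Products of single letters\<close>

lemmas T_simps = W_mult_copy T_mult_K_K T_mult_L_L T_mult_L_K T_mult_K_L

lemma K_K: "i = k \<or> j = l \<Longrightarrow> K p i j \<cdot> K p k l = K p i l"
  using mul_basic[OF in_carrier(1,1), of p i j p k l] by (auto simp: T_simps)

text \<open>Such a pair is basic only if the letter of \<open>L_G\<close> fixes the column or the
  row of the other letter. Every column but \<infinity> is fixed; in column \<infinity> only the
  rows \<open>x\<close> and \<open>y\<close>-bar qualify.\<close>

lemma L_K:
  assumes "L_data R x y z"
  shows "L x y z \<cdot> K p (Inl a) (Some j) = K p (Inl x) (Some j)"
    "L x y z \<cdot> K p (Inr a) (Some j) = K p (Inr y) (Some j)"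
    "L x y z \<cdot> K p (Inl x) None = K p (Inl x) None"
    "L x y z \<cdot> K p (Inr y) None = K p (Inr y) None"
    "K p i (Some j) \<cdot> L x y z = K p i (Some j)"
    "K p (Inl x) None \<cdot> L x y z = K p (Inl x) (Some z)"
    "K p (Inr y) None \<cdot> L x y z = K p (Inr y) (Some z)"
  by (subst mul_basic; simp add: in_carrier assms T_simps)+

lemma L_L:
  assumes "L_data R x y z" "L_data R x' y' z'" shows "L x y z \<cdot> L x' y' z' = L x y z"
  by (subst mul_basic; simp add: in_carrier assms T_simps)

lemma L_KH:
  assumes "L_data R x y z" "b \<in> B1"
  shows "L x y z \<cdot> KH a b = KH x b" "KH a b \<cdot> L x y z = KH a b"
  by (subst mul_basic; simp add: in_carrier(3)[OF assms(1)] in_carrier(4)[OF assms(2)] T_simps)+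

lemma KH_K_basic:
  assumes "b \<in> B1"
  shows "KH a b \<cdot> K p k (Some b) = K p (Inl a) (Some b)" "KH a b \<cdot> K p (Inl a) l = K p (Inl a) l"
    "K p k (Some b) \<cdot> KH a b = K p k (Some b)" "K p (Inl a) l \<cdot> KH a b = K p (Inl a) (Some b)"
  by (subst mul_basic; simp add: in_carrier(1) in_carrier(4)[OF assms(1)] T_simps)+

lemma L_data_simps: "L_data R None a a" "L_data R a a None"
  by (simp_all add: L_data_def)

text \<open>\<open>KH a b\<close> absorbs a letter of \<open>L_G\<close>, which moves the second
  factor to row 1; used backwards, this moves it to row \<open>a\<close>, where the pair is basic.
  So \<open>K_H\<close>, unlike the copies of \<open>K_G\<close>, stays a rectangular band.\<close>

lemma KH_KH:
  assumes "b \<in> B1" "b' \<in> B1" shows "KH a b \<cdot> KH a' b' = KH a b'"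
proof -
  have eq: "KH a b \<cdot> KH a b' = KH a b'"
    by (subst mul_basic; simp add: in_carrier(4)[OF assms(1)] in_carrier(4)[OF assms(2)] T_simps)
  have "KH a b \<cdot> KH a' b' = (KH a b \<cdot> L None None None) \<cdot> KH a' b'"
    using assms by (simp only: L_KH(2)[OF L_data_simps(1)])
  also have "\<dots> = KH a b \<cdot> KH None b'"
    using assms by (simp only: L_KH(1)[OF L_data_simps(1)] IG_mult_assoc)
  also have "\<dots> = (KH a b \<cdot> L None None None) \<cdot> KH a b'"
    using assms by (simp only: L_KH(1)[OF L_data_simps(1)] IG_mult_assoc)
  also have "\<dots> = KH a b'"
    using assms eq by (simp only: L_KH(2)[OF L_data_simps(1)])
  finally show ?thesis .
qed

text \<open>Next to a letter of a copy, a letter of \<open>K_H\<close> may be read as the letter of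
  that copy in the same position. Splitting off a letter in column \<open>b\<close>, or in row
  \<open>a\<close>, makes the pairs involved basic. As \<open>p\<close> is arbitrary, the letter can
  join either side of the border.\<close>

lemma KH_K:
  assumes "b \<in> B1"
  shows "KH a b \<cdot> K p k l = K p (Inl a) (Some b) \<cdot> K p k l"
    "K p k l \<cdot> KH a b = K p k l \<cdot> K p (Inl a) (Some b)"
proof -
  have "KH a b \<cdot> K p k l = KH a b \<cdot> (K p k (Some b) \<cdot> K p k l)"
    by (simp add: K_K)
  also have "\<dots> = K p (Inl a) (Some b) \<cdot> K p k l"
    by (simp only: KH_K_basic[OF assms] flip: IG_mult_assoc)
  finally show "KH a b \<cdot> K p k l = K p (Inl a) (Some b) \<cdot> K p k l" .
  have "K p k l \<cdot> KH a b = K p k l \<cdot> K p (Inl a) l \<cdot> KH a b"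
    by (simp add: K_K)
  also have "\<dots> = K p k l \<cdot> K p (Inl a) (Some b)"
    by (simp only: KH_K_basic[OF assms] IG_mult_assoc)
  finally show "K p k l \<cdot> KH a b = K p k l \<cdot> K p (Inl a) (Some b)" .
qed

text \<open>The left factor is not in column \<infinity>, hence absorbs \<open>L k' k' None\<close>,
  which sends every unbarred row to \<open>k'\<close>. That letter lies in neither copy, so
  \<open>p\<close> and \<open>q\<close> may differ.\<close>

lemma K_K_Inl:
  "K p i (Some j) \<cdot> K q (Inl k) (Some l) = K p i (Some j) \<cdot> K q (Inl k') (Some l)"
proof -
  have "K p i (Some j) \<cdot> K q (Inl k) (Some l) = K p i (Some j) \<cdot> L k' k' None \<cdot> K q (Inl k) (Some l)"
    by (simp only: L_K(5)[OF L_data_simps(2)])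
  then show ?thesis
    by (simp only: L_K(1)[OF L_data_simps(2)] IG_mult_assoc)
qed

lemma K_K_Inr:
  "K p i (Some j) \<cdot> K q (Inr k) (Some l) = K p i (Some j) \<cdot> K q (Inr k') (Some l)"
proof -
  have "K p i (Some j) \<cdot> K q (Inr k) (Some l) = K p i (Some j) \<cdot> L k' k' None \<cdot> K q (Inr k) (Some l)"
    by (simp only: L_K(5)[OF L_data_simps(2)])
  then show ?thesis
    by (simp only: L_K(2)[OF L_data_simps(2)] IG_mult_assoc)
qed

lemma K_K_same_side:
  "K p (Inl i) (Some j) \<cdot> K p (Inl k) (Some l) = K p (Inl i) (Some l)"
  "K p (Inr i) (Some j) \<cdot> K p (Inr k) (Some l) = K p (Inr i) (Some l)"
  using K_K_Inl[of p "Inl i" j p k l i] K_K_Inr[of p "Inr i" j p k l i] by (simp_all add: K_K)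

lemma K_inf_Inr:
  "K p i None \<cdot> K q (Inr a) (Some l) = K p i None \<cdot> K p (Inr a) (Some None) \<cdot> K q (Inr a) (Some l)"
proof -
  have "K p i None \<cdot> K q (Inr a) (Some l) = K p i None \<cdot> K p (Inr a) None \<cdot> (L a a None \<cdot> K q (Inr a) (Some l))"
    by (simp add: K_K L_K(2)[OF L_data_simps(2)])
  also have "\<dots> = K p i None \<cdot> (K p (Inr a) None \<cdot> L a a None) \<cdot> K q (Inr a) (Some l)"
    by (simp only: IG_mult_assoc)
  finally show ?thesis
    by (simp only: L_K(7)[OF L_data_simps(2)])
qed

lemma K_Inl_inf:
  "K p (Inl None) None \<cdot> K q (Inr a) (Some l) = K p (Inl None) (Some a) \<cdot> K q (Inr a) (Some l)"
proof -
  have "K p (Inl None) None \<cdot> K q (Inr a) (Some l)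
    = K p (Inl None) None \<cdot> (L None a a \<cdot> K q (Inr a) (Some l))"
    by (simp only: L_K(2)[OF L_data_simps(1)])
  then show ?thesis
    by (simp only: L_K(6)[OF L_data_simps(1)] flip: IG_mult_assoc)
qed

text \<open>This is the singular square of \<open>L x y z\<close>: in column \<infinity> a letter of
  row \<open>y\<close>-bar can be split off, and the inserted letter moves it to column
  \<open>z\<close> while fixing row \<open>x\<close> on its other side.\<close>

lemma K_inf_data:
  assumes "L_data R x y z"
  shows "K p i None \<cdot> K q (Inl x) (Some l) = K p i None \<cdot> K p (Inr y) (Some z) \<cdot> K q (Inl x) (Some l)"
proof -
  have "K p i None \<cdot> K q (Inl x) (Some l)
    = K p i None \<cdot> K p (Inr y) None \<cdot> (L x y z \<cdot> K q (Inl x) (Some l))"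
    by (simp add: K_K L_K(1)[OF assms])
  also have "\<dots> = K p i None \<cdot> (K p (Inr y) None \<cdot> L x y z) \<cdot> K q (Inl x) (Some l)"
    by (simp only: IG_mult_assoc)
  finally show ?thesis
    by (simp only: L_K(7)[OF assms])
qed

section \<open>Group words at row 1 and column 1\<close>

lemma K_word_append: "cl (K_word p (u @ v)) = cl (K_word p u) \<cdot> cl (K_word p v)"
proof -
  let ?k = "copy p (K_pair (Inl None) (Some None))"
  let ?b = "\<lambda>(a, e). if e then [copy p (K_pair (Inr None) (Some (Some a))), ?k]
     else [copy p (K_pair (Inl None) (Some (Some a))), copy p (K_pair (Inr None) (Some None))]"
  let ?c = "\<lambda>w. concat (map ?b w)"
  \<comment> \<open>Every block ends in column 1, so the idempotent at row 1 and column 1 is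
    absorbed from the right; it becomes the leading letter of the second word.\<close>
  have eq: "cl (?k # ?c u) = cl (?k # ?c u @ [?k])"
  proof (cases u rule: rev_exhaust)
    case Nil
    then show ?thesis using K_K[of "Inl None" "Inl None"  "Some None" "Some None" p]
      by (simp add: IG_mult_class)
  next
    case (snoc w x)
    have absorb: "cl [c, copy p (K_pair i (Some None)), ?k] = cl [c, copy p (K_pair i (Some None))]" for c i
    proof -
      have "cl [c] \<cdot> (K p i (Some None) \<cdot> K p (Inl None) (Some None)) = cl [c] \<cdot> K p i (Some None)"
        by (simp add: K_K)
      then show ?thesis by (simp add: IG_mult_class)
    qed
    have "cl (?b x) = cl (?b x @ [?k])"
      by (cases x) (auto simp only: split_conv append.simps absorb split: if_split)
    then have "cl (?k # ?c w) \<cdot> cl (?b x) = cl (?k # ?c w) \<cdot> cl (?b x @ [?k])"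
      by simp
    then show ?thesis by (simp add: snoc IG_mult_class)
  qed
  have "cl (?k # ?c u) \<cdot> cl (?c v) = cl (?k # ?c u @ [?k]) \<cdot> cl (?c v)"
    by (rule arg_cong[OF eq])
  then show ?thesis by (simp add: K_word_def IG_mult_class)
qed

lemma K_word_Nil: "cl (K_word p []) = K p (Inl None) (Some None)"
  by (simp add: K_word_def)

lemma K_word_True:
  "cl (K_word p [(a, True)]) =
    K p (Inl None) (Some None) \<cdot> K p (Inr None) (Some (Some a)) \<cdot> K p (Inl None) (Some None)"
  by (simp add: K_word_def IG_mult_class)

lemma K_word_False:
  "cl (K_word p [(a, False)]) = K p (Inl None) (Some (Some a)) \<cdot> K p (Inr None) (Some None)"
proof -
  have "cl (K_word p [(a, False)]) = K p (Inl None) (Some None) \<cdot> K p (Inl None) (Some (Some a))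
    \<cdot> K p (Inr None) (Some None)"
    by (simp add: K_word_def IG_mult_class)
  then show ?thesis by (simp add: K_K)
qed

lemma K_K_left:
  assumes "i = k \<or> j = l" shows "K p i j \<cdot> (K p k l \<cdot> x) = K p i l \<cdot> x"
  using K_K[OF assms, of p] by (simp flip: IG_mult_assoc)

lemma K_word_inverse: "cl (K_word p [(a, e), (a, \<not> e)]) = K p (Inl None) (Some None)"
proof -
  have "cl (K_word p [(a, e), (a, \<not> e)]) = cl (K_word p [(a, e)]) \<cdot> cl (K_word p [(a, \<not> e)])"
    by (simp flip: K_word_append)
  also have "\<dots> = K p (Inl None) (Some None)"
    by (cases e) (simp_all add: K_word_True K_word_False IG_mult_assoc K_K K_K_left)
  finally show ?thesis .
qed

text \<open>All barred rows agree outside column \<infinity>. In column \<infinity>, row a reduces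
  to row a-bar by \<open>L_pair a a None\<close>, and row a-bar reduces to column a by
  \<open>L_pair None a a\<close>.\<close>

lemma K_sandwich: "K p (Inl None) j \<cdot> K p k (Some None) = cl (K_word p (sandwich j k))"
proof -
  have 1: "K p (Inl None) (Some b) \<cdot> K p (Inr a) (Some None)
    = cl (K_word p (sandwich (Some b) (Inr a)))" for a b
    using K_K_Inr[of p "Inl None" b p a None None]
    by (cases b) (simp_all add: K_word_Nil K_word_False K_K)
  have 2: "K p (Inl None) None \<cdot> K p (Inr a) (Some None) = cl (K_word p (sandwich None (Inr a)))" for a
    using 1[of a a] by (cases a) (simp_all add: K_Inl_inf)
  have 3: "K p (Inl None) None \<cdot> K p (Inl a) (Some None)
      = K p (Inl None) None \<cdot> K p (Inr a) (Some None)" for a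
    using K_inf_data[OF L_data_simps(2), of p "Inl None" p a None]
    by (simp add: K_K IG_mult_assoc)
  show ?thesis
  proof (cases k)
    case (Inl a)
    show ?thesis
    proof (cases j)
      case None
      then show ?thesis using Inl 2[of a] 3[of a] by (cases a) simp_all
    next
      case (Some b)
      then show ?thesis using Inl by (simp add: K_K_same_side K_word_Nil)
    qed
  next
    case (Inr a)
    then show ?thesis using 1 2 by (cases j) simp_all
  qed
qed

text \<open>The product of column \<infinity> with row b is the inverse of b. Read through the
  singular square of the relation it becomes the inverse of c times a, which is ab = c
  rearranged.\<close>

lemma K_word_relation:
  assumes "(a, b, c) \<in> R"
  shows "cl (K_word p [(a, True), (b, True)]) = cl (K_word p [(c, True)])"
proof -
  let ?g = "\<lambda>w. cl (K_word p w)"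
  have data: "L_data R (Some b) (Some c) (Some a)" using assms by (auto simp: L_data_def)
  have "?g [(b, False)] = K p (Inl None) None \<cdot> K p (Inl (Some b)) (Some None)"
    by (simp add: K_sandwich)
  also have "\<dots> = K p (Inl None) None \<cdot> K p (Inr (Some c)) (Some (Some a)) \<cdot> K p (Inl (Some b)) (Some None)"
    by (rule K_inf_data[OF data])
  also have "\<dots> = K p (Inl None) None \<cdot> K p (Inr (Some c)) (Some None)
      \<cdot> (K p (Inr (Some c)) (Some (Some a)) \<cdot> K p (Inl (Some b)) (Some None))"
    by (simp add: IG_mult_assoc K_K_left)
  also have "\<dots> = ?g [(c, False)] \<cdot> (K p (Inr (Some c)) (Some (Some a)) \<cdot> K p (Inl None) (Some None))"
    by (simp add: K_sandwich K_K_Inl[of p _ _ p "Some b" _ None])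
  also have "\<dots> = K p (Inl None) (Some (Some c)) \<cdot> (K p (Inr None) (Some None)
      \<cdot> K p (Inr (Some c)) (Some (Some a))) \<cdot> K p (Inl None) (Some None)"
    by (simp add: K_word_False IG_mult_assoc)
  also have "\<dots> = K p (Inl None) (Some (Some c)) \<cdot> K p (Inr None) (Some (Some a)) \<cdot> K p (Inl None) (Some None)"
    by (simp add: K_K_same_side)
  also have "\<dots> = ?g [(c, False)] \<cdot> ?g [(a, True)]"
    by (simp add: K_word_False K_word_True IG_mult_assoc K_K K_K_left)
  finally have eq: "?g [(b, False)] = ?g [(c, False)] \<cdot> ?g [(a, True)]" .
  have unit: "?g w \<cdot> ?g [] = ?g w" "?g [] \<cdot> ?g w = ?g w" for w
    by (simp_all flip: K_word_append)
  have inv: "?g [(d, True)] \<cdot> ?g [(d, False)] = ?g []" "?g [(d, False)] \<cdot> ?g [(d, True)] = ?g []" for d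
    using K_word_inverse[of p d True] K_word_inverse[of p d False]
    by (simp_all add: K_word_Nil flip: K_word_append)
  have "?g [(c, True)] = ?g [(c, True)] \<cdot> (?g [(b, False)] \<cdot> ?g [(b, True)])"
    by (simp add: inv unit)
  also have "\<dots> = ?g [(c, True)] \<cdot> ?g [(c, False)] \<cdot> ?g [(a, True)] \<cdot> ?g [(b, True)]"
    by (simp only: eq IG_mult_assoc)
  also have "\<dots> = ?g [(a, True)] \<cdot> ?g [(b, True)]"
    by (simp only: inv unit)
  finally show ?thesis by (simp flip: K_word_append)
qed

lemma K_word_pres_cong:
  "pres_cong UNIV (triple_relations R \<union> free_reductions) u v \<Longrightarrow> cl (K_word p u) = cl (K_word p v)"
proof (induction rule: pres_cong.induct)
  case (rel u v)
  then show ?case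
    by (auto simp: triple_relations_def free_reductions_def K_word_relation K_word_inverse K_word_Nil)
next
  case (mult u v u' v')
  then show ?case by (simp add: K_word_append)
qed auto

text \<open>The outer letters only carry the group element to row \<open>i\<close> and column
  \<open>j\<close>: sandwich entries in column 1 and in row 1 are trivial.\<close>

definition rees :: "bool \<Rightarrow> 'a I \<Rightarrow> ('a \<times> bool) list \<Rightarrow> 'a J \<Rightarrow> 'a T W list set" where
  "rees p i w j = K p i (Some None) \<cdot> cl (K_word p w) \<cdot> K p (Inl None) j"

lemma rees_mult: "rees p i w j \<cdot> rees p k w' l = rees p i (w @ sandwich j k @ w') l"
  by (simp add: rees_def K_word_append IG_mult_assoc flip: K_sandwich)

definition inv_word :: "('a \<times> bool) list \<Rightarrow> ('a \<times> bool) list" where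
  "inv_word w = rev (map (\<lambda>(a, e). (a, \<not> e)) w)"

lemma sandwich_inverse:
  "cl (K_word p (sandwich j i)) \<cdot> cl (K_word p (inv_word (sandwich j i))) = K p (Inl None) (Some None)"
  by (cases "(j, i)" rule: sandwich.cases)
    (simp_all add: inv_word_def K_word_inverse[of _ _ False, simplified] K_word_Nil K_K
      flip: K_word_append)

lemma K_eq_rees: "K p i j = rees p i (inv_word (sandwich j i)) j"
proof -
  let ?q = "cl (K_word p (inv_word (sandwich j i)))"
  have "rees p i (inv_word (sandwich j i)) j = K p i j \<cdot> K p i (Some None) \<cdot> ?q \<cdot> K p (Inl None) j"
    by (simp add: rees_def K_K)
  \<comment> \<open>\<open>K p i j\<close> absorbs a letter of its own column, which puts the
    sandwich entry next to its inverse.\<close>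
  also have "\<dots> = K p i j \<cdot> (K p (Inl None) j \<cdot> K p i (Some None)) \<cdot> ?q \<cdot> K p (Inl None) j"
    by (simp add: K_K flip: IG_mult_assoc)
  also have "\<dots> = K p i j \<cdot> (cl (K_word p (sandwich j i)) \<cdot> ?q) \<cdot> K p (Inl None) j"
    by (simp only: K_sandwich IG_mult_assoc)
  also have "\<dots> = K p i j"
    by (simp add: sandwich_inverse K_K IG_mult_assoc)
  finally show ?thesis by simp
qed

section \<open>Closure of the Rees matrix semigroups under the letters of \<open>L_G\<close> and
  \<open>K_H\<close>\<close>

definition Rees :: "bool \<Rightarrow> 'a T W list set set" where
  "Rees p = {rees p i w j | i w j. True}"

lemma K_in_Rees: "K p i j \<in> Rees p"
  unfolding Rees_def using K_eq_rees by blast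

lemma Rees_mult: "x \<in> Rees p \<Longrightarrow> y \<in> Rees p \<Longrightarrow> x \<cdot> y \<in> Rees p"
  unfolding Rees_def using rees_mult by blast

lemma Rees_L:
  assumes "x \<in> Rees p" "L_data R a b c"
  shows "L a b c \<cdot> x \<in> Rees p" "x \<cdot> L a b c \<in> Rees p"
proof -
  obtain i w j where x: "x = rees p i w j" using assms(1) by (auto simp: Rees_def)
  obtain k where k: "L a b c \<cdot> K p i (Some None) = K p k (Some None)"
    using L_K(1,2)[OF assms(2)] by (cases i) metis+
  have "L a b c \<cdot> x = L a b c \<cdot> K p i (Some None) \<cdot> cl (K_word p w) \<cdot> K p (Inl None) j"
    by (simp add: x rees_def IG_mult_assoc)
  then have "L a b c \<cdot> x = rees p k w j"
    by (simp add: rees_def k)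
  then show "L a b c \<cdot> x \<in> Rees p" by (auto simp: Rees_def)
  show "x \<cdot> L a b c \<in> Rees p"
  proof (cases j)
    case None
    \<comment> \<open>In column \<infinity> a letter of row \<open>a\<close> can be split off, on
      which the letter of \<open>L_G\<close> acts by a defining relation.\<close>
    have "x \<cdot> L a b c = K p i (Some None) \<cdot> cl (K_word p w) \<cdot> K p (Inl None) j \<cdot> K p (Inl a) None \<cdot> L a b c"
      by (simp add: x rees_def IG_mult_assoc K_K_left None)
    also have "\<dots> = x \<cdot> K p (Inl a) (Some c)"
      by (simp add: x rees_def IG_mult_assoc L_K(6)[OF assms(2)])
    finally show ?thesis using assms(1) K_in_Rees Rees_mult by metis
  next
    case (Some d)
    then have "x \<cdot> L a b c = x"
      by (simp add: x rees_def IG_mult_assoc L_K(5)[OF assms(2)])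
    then show ?thesis using assms(1) by simp
  qed
qed

lemma Rees_KH:
  assumes "x \<in> Rees p" "b \<in> B1"
  shows "KH a b \<cdot> x \<in> Rees p" "x \<cdot> KH a b \<in> Rees p"
proof -
  obtain i w j where x: "x = rees p i w j" using assms(1) by (auto simp: Rees_def)
  have "KH a b \<cdot> x = KH a b \<cdot> K p i (Some None) \<cdot> (cl (K_word p w) \<cdot> K p (Inl None) j)"
    by (simp add: x rees_def IG_mult_assoc)
  also have "\<dots> = K p (Inl a) (Some b) \<cdot> x"
    by (simp add: x rees_def IG_mult_assoc KH_K[OF assms(2)])
  finally show "KH a b \<cdot> x \<in> Rees p" using assms(1) K_in_Rees Rees_mult by metis
  have "x \<cdot> KH a b = x \<cdot> K p (Inl a) (Some b)"
    by (simp add: x rees_def IG_mult_assoc KH_K[OF assms(2)])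
  then show "x \<cdot> KH a b \<in> Rees p" using assms(1) K_in_Rees Rees_mult by metis
qed

text \<open>The cycle \<open>(1, 1)\<close>, \<open>(b, -1)\<close>, \<open>(\<infinity>, -b)\<close>, \<open>(1, -b)\<close>, \<open>(1, 1)\<close> of (column, row) positions
  at the border between the two copies, with \<open>-a\<close> the barred copy of \<open>a\<close>, moves the inverse of \<open>b\<close>
  across it.\<close>

lemma K_word_transfer:
  assumes "b \<in> B"
  shows "cl (K_word True [(b, False)]) \<cdot> K False (Inl None) (Some None)
    = K True (Inl None) (Some None) \<cdot> cl (K_word False [(b, False)])"
proof -
  let ?b = "Some b"
  have B1: "?b \<in> B1" "None \<in> B1" using assms by auto
  have "K True (Inl None) (Some None) \<cdot> cl (K_word False [(b, False)])
    = K True (Inl None) (Some None) \<cdot> K False (Inl None) (Some ?b) \<cdot> K False (Inr None) (Some None)"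
    by (simp add: K_word_False IG_mult_assoc)
  \<comment> \<open>The letter of the second copy in row 1 and column b is traded for its
    counterpart in \<open>K_H\<close>, which the first copy then absorbs.\<close>
  also have "\<dots> = K True (Inl None) (Some None) \<cdot> (KH None ?b \<cdot> K False (Inr None) (Some None))"
    by (simp only: KH_K[OF B1(1)] IG_mult_assoc)
  also have "\<dots> = K True (Inl None) (Some ?b) \<cdot> K False (Inr None) (Some None)"
    by (simp only: KH_K_basic(4)[OF B1(1)] flip: IG_mult_assoc)
  also have "\<dots> = K True (Inl None) (Some ?b) \<cdot> K False (Inr ?b) (Some None)"
    by (rule K_K_Inr)
  also have "\<dots> = K True (Inl None) None \<cdot> K False (Inr ?b) (Some None)"
    by (simp only: K_Inl_inf)
  also have "\<dots> = K True (Inl None) None \<cdot> K True (Inr ?b) (Some None) \<cdot> K False (Inr ?b) (Some None)"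
    by (rule K_inf_Inr)
  also have "\<dots> = cl (K_word True [(b, False)]) \<cdot> K True (Inl None) (Some None) \<cdot> K False (Inr ?b) (Some None)"
    by (simp add: K_sandwich flip: K_word_Nil K_word_append)
  \<comment> \<open>The first copy releases the letter of \<open>K_H\<close> in row 1 and column 1,
    which sends row b-bar of the second copy to row 1.\<close>
  also have "\<dots> = cl (K_word True [(b, False)]) \<cdot> (K True (Inl None) (Some None) \<cdot> KH None None) \<cdot> K False (Inr ?b) (Some None)"
    by (simp only: KH_K_basic(3)[OF B1(2)])
  also have "\<dots> = cl (K_word True [(b, False)]) \<cdot> K True (Inl None) (Some None) \<cdot> (KH None None \<cdot> K False (Inr ?b) (Some None))"
    by (simp only: IG_mult_assoc)
  also have "\<dots> = cl (K_word True [(b, False)]) \<cdot> K False (Inl None) (Some None)"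
    by (simp only: KH_K_basic(1)[OF B1(2)]) (simp flip: K_word_Nil[of True] K_word_append)
  finally show ?thesis by simp
qed

lemma K_word_transfer_list:
  assumes "set w \<subseteq> B \<times> {False}"
  shows "cl (K_word True w) \<cdot> K False (Inl None) (Some None)
    = K True (Inl None) (Some None) \<cdot> cl (K_word False w)"
  using assms
proof (induction w)
  case Nil
  then show ?case by (simp add: K_word_Nil)
next
  case (Cons x w)
  then obtain b where x: "x = (b, False)" "b \<in> B" by auto
  let ?e = "K False (Inl None) (Some None)" and ?e' = "K True (Inl None) (Some None)"
  have unit: "cl (K_word False u) = ?e \<cdot> cl (K_word False u)"
    "cl (K_word True u) = cl (K_word True u) \<cdot> ?e'" for u
    by (simp_all flip: K_word_Nil K_word_append)
  have "cl (K_word True (x # w)) \<cdot> ?e = cl (K_word True [x]) \<cdot> (cl (K_word True w) \<cdot> ?e)"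
    using K_word_append[of True "[x]" w] by (simp add: IG_mult_assoc)
  also have "\<dots> = cl (K_word True [x]) \<cdot> ?e' \<cdot> cl (K_word False w)"
    using Cons by (simp add: IG_mult_assoc)
  also have "\<dots> = cl (K_word True [x]) \<cdot> (?e \<cdot> cl (K_word False w))"
    by (simp flip: unit)
  also have "\<dots> = ?e' \<cdot> (cl (K_word False [x]) \<cdot> cl (K_word False w))"
    using K_word_transfer[OF x(2)] by (simp add: x flip: IG_mult_assoc)
  also have "\<dots> = ?e' \<cdot> cl (K_word False (x # w))"
    using K_word_append[of False "[x]" w] by simp
  finally show ?case .
qed

end


section \<open>The action of \<open>IG\<close>\<close>

locale IG_band_group = IG_band R B + group G
  for R :: "('a::finite \<times> 'a \<times> 'a) set" and B :: "'a set" and G :: "'g monoid" (structure) +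
  fixes \<phi> :: "'a \<Rightarrow> 'g" and H :: "'g set"
  assumes presentation: "group_presentation G \<phi> (triple_relations R)"
    and subgroup: "subgroup H G"
    and generators: "generate G (\<phi> ` B) = H"
    and inverses: "\<forall>b\<in>B. inv (\<phi> b) \<in> \<phi> ` B"
begin

section \<open>Values of group words\<close>

abbreviation "val \<equiv> word_val G \<phi>"

lemma phi_closed [simp]: "\<phi> a \<in> carrier G"
  using presentation by (auto simp: group_presentation_def)

lemma val_simps [simp]:
  "val [] = \<one>" "val ((a, True) # w) = \<phi> a \<otimes> val w" "val ((a, False) # w) = inv (\<phi> a) \<otimes> val w"
  by (simp_all add: word_val_def letter_val_def)

lemma val_closed [simp]: "val w \<in> carrier G"
  by (induction w) (auto simp: word_val_def letter_val_def)

lemma val_append [simp]: "val (u @ v) = val u \<otimes> val v"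
proof (induction u)
  case (Cons x u)
  then show ?case by (cases x; cases "snd x") (auto simp: m_assoc)
qed simp

lemma val_inv_word [simp]: "val (inv_word w) = inv (val w)"
proof (induction w)
  case (Cons x w)
  have "val (inv_word (x # w)) = val (inv_word w) \<otimes> val (inv_word [x])"
    by (simp add: inv_word_def)
  then show ?case using Cons by (cases x; cases "snd x") (auto simp: inv_word_def inv_mult_group)
qed (simp add: inv_word_def)

lemma val_eq_iff: "val u = val v \<longleftrightarrow> pres_cong UNIV (triple_relations R \<union> free_reductions) u v"
  using presentation by (simp add: group_presentation_def)

lemma val_surj:
  assumes "g \<in> carrier G" shows "\<exists>w. val w = g"
proof -
  have "g \<in> generate G (range \<phi>)"
    using assms presentation by (simp add: group_presentation_def)
  then show ?thesis
  proof induction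
    case one
    then show ?case by (metis val_simps(1))
  next
    case (incl h)
    then obtain a where "h = \<phi> a" by blast
    then show ?case by (intro exI[of _ "[(a, True)]"]) simp
  next
    case (inv h)
    then obtain a where "h = \<phi> a" by blast
    then show ?case by (intro exI[of _ "[(a, False)]"]) simp
  next
    case (eng h1 h2)
    then show ?case by (metis val_append)
  qed
qed

text \<open>The border cycle transfers inverses of letters, hence words in inverse letters only. A
  positive letter b is rewritten as the inverse of the letter in \<open>B\<close> that represents
  the inverse of b.\<close>

lemma val_H:
  assumes "h \<in> H" shows "\<exists>w. set w \<subseteq> B \<times> {False} \<and> val w = h"
proof -
  have "h \<in> generate G (\<phi> ` B)" using assms generators by simp
  then show ?thesis
  proof induction
    case one
    then show ?case by (intro exI[of _ "[]"]) simp
  next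
    case (incl h)
    then obtain b where b: "h = \<phi> b" "b \<in> B" by blast
    then obtain b' where "inv (\<phi> b) = \<phi> b'" "b' \<in> B" using inverses by blast
    then show ?case using b by (intro exI[of _ "[(b', False)]"]) (auto simp flip: \<open>inv (\<phi> b) = \<phi> b'\<close>)
  next
    case (inv h)
    then obtain b where "h = \<phi> b" "b \<in> B" by blast
    then show ?case by (intro exI[of _ "[(b, False)]"]) simp
  next
    case (eng h1 h2)
    then obtain u v where "set u \<subseteq> B \<times> {False}" "set v \<subseteq> B \<times> {False}" "val u = h1" "val v = h2"
      by blast
    then show ?case by (intro exI[of _ "u @ v"]) simp
  qed
qed

definition gen :: "'a A1 \<Rightarrow> 'g" where
  "gen x = (case x of None \<Rightarrow> \<one> | Some a \<Rightarrow> \<phi> a)"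

text \<open>The inverse of the \<open>(j, i)\<close> entry of the Rees sandwich matrix.\<close>

definition entry :: "'a I \<Rightarrow> 'a J \<Rightarrow> 'g" where
  "entry i j = (case j of
     None \<Rightarrow> gen (case i of Inl a \<Rightarrow> a | Inr a \<Rightarrow> a)
   | Some b \<Rightarrow> (case i of Inl _ \<Rightarrow> \<one> | Inr _ \<Rightarrow> gen b))"

lemma gen_closed [simp]: "gen x \<in> carrier G"
  by (simp add: gen_def split: option.split)

lemma entry_closed [simp]: "entry i j \<in> carrier G"
  by (simp add: entry_def split: option.split sum.split)

lemma entry_unit [simp]: "entry (Inl a) (Some b) = \<one>" "entry i (Some None) = \<one>" "entry (Inl None) j = \<one>"
  by (simp_all add: entry_def gen_def split: option.split sum.split)

lemma val_sandwich: "val (sandwich j i) = inv (entry i j)"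
  by (cases "(j, i)" rule: sandwich.cases)
    (simp_all add: entry_def gen_def split: sum.split option.split)

lemma L_data_gen:
  assumes "L_data R x y z" shows "gen z \<otimes> gen x = gen y"
proof -
  have "\<phi> a \<otimes> \<phi> b = \<phi> c" if "(a, b, c) \<in> R" for a b c
  proof -
    have "([(a, True), (b, True)], [(c, True)]) \<in> triple_relations R \<union> free_reductions"
      using that by (auto simp: triple_relations_def)
    then have "val [(a, True), (b, True)] = val [(c, True)]"
      unfolding val_eq_iff by (intro pres_cong.rel) auto
    then show ?thesis by simp
  qed
  then show ?thesis using assms by (auto simp: L_data_def gen_def split: option.split)
qed

text \<open>For a constant pair this is a sandwich entry times the group component of an idempotent,
  that is, right multiplication in the Rees matrix semigroup at column \<open>j\<close>. The row
  \<open>fst t (Inl None)\<close> is a representative of the image of \<open>fst t\<close>.\<close>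

definition right_mult :: "'a T \<Rightarrow> 'a J \<Rightarrow> 'g" where
  "right_mult t j = inv (entry (fst t (Inl None)) j) \<otimes> entry (fst t (Inl None)) (snd t j)"

text \<open>The two conditions say that the right, respectively left, action of \<open>t\<close> on the Rees matrix
  semigroup is well defined.\<close>

definition linked :: "'a T \<Rightarrow> bool" where
  "linked t \<longleftrightarrow>
     (\<forall>i j. inv (entry (fst t i) j) \<otimes> entry (fst t i) (snd t j) = right_mult t j) \<and>
     (\<forall>i j j'. entry (fst t i) (snd t j) \<otimes> inv (entry i (snd t j)) =
        entry (fst t i) (snd t j') \<otimes> inv (entry i (snd t j')))"

lemma linked_K: "linked (K_pair i j)"
  by (simp add: linked_def right_mult_def K_pair_def)

lemma linked_L:
  assumes "L_data R x y z" shows "linked (L_pair x y z)"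
proof -
  \<comment> \<open>The only comparison of rows that is not immediate occurs in column \<infinity>,
    between rows \<open>x\<close> and \<open>y\<close>-bar; it is zx = y rearranged.\<close>
  have "inv (gen y) \<otimes> gen z = inv (gen x)"
    unfolding L_data_gen[OF assms, symmetric] by (simp add: inv_mult_group m_assoc)
  then show ?thesis
    by (auto simp: linked_def right_mult_def L_pair_def entry_def split: sum.splits option.splits)
qed

lemma right_mult_closed [simp]: "right_mult t j \<in> carrier G"
  by (simp add: right_mult_def)

lemma right_mult_eq: "linked t \<Longrightarrow> right_mult t j = inv (entry (fst t i) j) \<otimes> entry (fst t i) (snd t j)"
  by (simp add: linked_def)

lemma inv_cancel:
  assumes "x \<in> carrier G" "y \<in> carrier G" "z \<in> carrier G"
  shows "(x \<otimes> y) \<otimes> (inv y \<otimes> z) = x \<otimes> z"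
  using assms by (metis inv_solve_left' l_inv m_assoc m_closed inv_closed r_inv r_one l_one)

lemma inv_mult_cancel:
  assumes "x \<in> carrier G" "y \<in> carrier G"
  shows "inv x \<otimes> (x \<otimes> y) = y" "x \<otimes> (inv x \<otimes> y) = y"
  using assms by (simp_all flip: m_assoc)

text \<open>\<open>right_mult\<close> is a quotient of two entries in one row, so the product
  telescopes once both factors are evaluated in a common row; if \<open>f\<close> fixes the column,
  its factor is trivial. When \<open>T_mult f e = f\<close> a common row may be missing, and the
  second condition of \<open>linked\<close> compares the two rows instead.\<close>

lemma right_mult_T_mult:
  assumes e: "linked e" and f: "linked f"
    and basic: "T_mult e f = e \<or> T_mult e f = f \<or> T_mult f e = e \<or> T_mult f e = f"
  shows "right_mult e j \<otimes> right_mult f (snd e j) = right_mult (T_mult e f) j"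
  using basic
proof (elim disjE)
  assume ef: "T_mult e f = e"
  then have "snd f (snd e j) = snd e j" by (simp add: T_mult_def prod_eq_iff fun_eq_iff)
  then have "right_mult f (snd e j) = \<one>" by (simp add: right_mult_def)
  then show ?thesis by (simp add: ef)
next
  assume ef: "T_mult e f = f"
  then have "fst e (fst f (Inl None)) = fst f (Inl None)" "snd f (snd e j) = snd f j"
    by (simp_all add: T_mult_def prod_eq_iff fun_eq_iff)
  with ef show ?thesis
    using right_mult_eq[OF e, of j "fst f (Inl None)"] by (simp add: right_mult_def T_mult_def inv_cancel)
next
  let ?s = "fst e (fst f (Inl None))"
  assume "T_mult f e = e"
  then have "fst f ?s = ?s" by (simp add: T_mult_def prod_eq_iff fun_eq_iff)
  then show ?thesis
    using right_mult_eq[OF e, of j "fst f (Inl None)"] right_mult_eq[OF f, of "snd e j" ?s]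
    by (simp add: right_mult_def[of "(fst e \<circ> fst f, snd f \<circ> snd e)"] T_mult_def inv_cancel)
next
  let ?i = "fst f (Inl None)" and ?k = "snd f (snd e j)"
  assume "T_mult f e = f"
  then have k: "snd e ?k = ?k" by (simp add: T_mult_def prod_eq_iff fun_eq_iff)
  have "entry (fst e ?i) (snd e j) \<otimes> inv (entry ?i (snd e j)) = entry (fst e ?i) ?k \<otimes> inv (entry ?i ?k)"
    using e k unfolding linked_def by metis
  then have "entry (fst e ?i) (snd e j) \<otimes> inv (entry ?i (snd e j)) \<otimes> entry ?i ?k = entry (fst e ?i) ?k"
    by (simp add: m_assoc)
  then have "inv (entry (fst e ?i) j) \<otimes> entry (fst e ?i) (snd e j) \<otimes> (inv (entry ?i (snd e j)) \<otimes> entry ?i ?k)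
      = inv (entry (fst e ?i) j) \<otimes> entry (fst e ?i) ?k"
    by (simp add: m_assoc)
  then show ?thesis
    using right_mult_eq[OF e, of j ?i]
    by (simp add: right_mult_def[of "(fst e \<circ> fst f, snd f \<circ> snd e)"] right_mult_def[of f] T_mult_def)
qed

text \<open>In a state \<open>(h, j, C)\<close> the entry \<open>C\<close> is the left coset of \<open>H\<close> determined by the part of the
  word before its first letter in the second copy.\<close>

type_synonym ('b, 'h) state = "('h \<times> 'b J \<times> 'h set option) option"

text \<open>\<open>Base\<close> letters and both copies act alike on group element and column. The
  first letter of the second copy sets the coset: the group element read so far, times the sandwich
  entry met on entering that letter's row. \<open>Zero\<close> leads to the sink
  \<open>None\<close>.\<close>

fun step :: "'a T W \<Rightarrow> ('a, 'g) state \<Rightarrow> ('a, 'g) state" where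
  "step (Base t) (Some (h, j, C)) = Some (h \<otimes> right_mult t j, snd t j, C)"
| "step (Copy1 t) (Some (h, j, C)) = Some (h \<otimes> right_mult t j, snd t j, C)"
| "step (Copy2 t) (Some (h, j, C)) = Some (h \<otimes> right_mult t j, snd t j,
     if C = None then Some ((h \<otimes> inv (entry (fst t (Inl None)) j)) <# H) else C)"
| "step _ _ = None"

definition states :: "('a, 'g) state set" where
  "states = insert None {Some (h, j, C) | h j C. h \<in> carrier G}"

lemma step_closed: "s \<in> states \<Longrightarrow> step e s \<in> states"
  by (cases "(e, s)" rule: step.cases) (auto simp: states_def)

lemma gen_B1: "b \<in> B1 \<Longrightarrow> gen b \<in> H"
  using generators subgroup.one_closed[OF subgroup] by (auto simp: gen_def intro: generate.incl)

text \<open>This factor arises when a \<open>Base\<close> letter is read before the second copy is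
  entered in row \<open>i\<close>, rather than multiplied into that copy. It is 1 for
  \<open>L_G\<close>; for \<open>K_H\<close> in column b it is 1 or the inverse of b, by the side of
  row \<open>i\<close>.\<close>

lemma Base_transfer:
  assumes "Base t \<in> carrier (B_GH R B)"
  shows "entry (fst t i) (snd t j) \<otimes> inv (entry i (snd t j)) \<in> H"
  using assms
proof (cases rule: carrier_cases)
  case (L x y z)
  have "entry (fst t i) (snd t j) = entry i (snd t j)"
    using L by (auto simp: L_pair_def entry_def split: sum.split option.split)
  then show ?thesis by (simp add: subgroup.one_closed[OF subgroup])
next
  case (KH a b)
  then show ?thesis
    using subgroup.m_inv_closed[OF subgroup gen_B1[OF KH(1)]] subgroup.one_closed[OF subgroup]
    by (auto simp: K_pair_def entry_def split: sum.split)
qed (auto simp: copy_def split: if_splits)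

lemma l_coset_mult_H:
  assumes "x \<in> carrier G" "y \<in> carrier G" "inv x \<otimes> y \<in> H" shows "x <# H = y <# H"
proof -
  have "y = x \<otimes> (inv x \<otimes> y)" using assms by (simp flip: m_assoc)
  then have "y <# H = x <# ((inv x \<otimes> y) <# H)"
    using assms subgroup.subset[OF subgroup] by (subst lcos_m_assoc) auto
  then show ?thesis using assms subgroup by (simp add: coset_join3)
qed

lemma step_basic:
  assumes basic: "basic_pair (B_GH R B) e f" and s: "s \<in> states"
  shows "step f (step e s) = step (e \<odot>\<^bsub>B_GH R B\<^esub> f) s"
proof -
  let ?m = "W_mult T_mult"
  have carr: "e \<in> carrier (B_GH R B)" "f \<in> carrier (B_GH R B)"
    and basic': "?m e f = e \<or> ?m e f = f \<or> ?m f e = e \<or> ?m f e = f"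
    using basic unfolding basic_pair_def carrier_E by (auto simp: B_GH_def)
  have linked: "linked t" if "Base t \<in> carrier (B_GH R B) \<or> Copy1 t \<in> carrier (B_GH R B) \<or>
      Copy2 t \<in> carrier (B_GH R B)" for t
    using that by (auto elim!: carrier_cases simp: linked_K linked_L copy_def split: if_splits)
  \<comment> \<open>Letters of the second copy are constant, so multiplying by a \<open>Base\<close>
    letter on the right leaves their row, and with it the recorded coset, unchanged.\<close>
  have const: "fst t (fst u i) = fst t (Inl None)" if "Copy2 t \<in> carrier (B_GH R B)" for t u :: "'a T" and i
    using that by (auto elim!: carrier_cases simp: K_pair_def copy_def split: if_splits)
  have mult: "h \<otimes> right_mult t j \<otimes> right_mult u (snd t j) = h \<otimes> right_mult (T_mult t u) j"
    if "linked t" "linked u" "T_mult t u = t \<or> T_mult t u = u \<or> T_mult u t = t \<or> T_mult u t = u"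
      "h \<in> carrier G" for h t u j
    using right_mult_T_mult[OF that(1-3)] that(4) by (simp add: m_assoc)
  \<comment> \<open>A product of a \<open>Base\<close> letter and a letter of a copy is never the
    \<open>Base\<close> letter. Accordingly only two of the four alternatives survive, depending on
    which factor is the \<open>Base\<close> letter.\<close>
  then have mult1: "h \<otimes> right_mult t j \<otimes> right_mult u (snd t j) = h \<otimes> right_mult (T_mult t u) j"
    if "linked t" "linked u" "T_mult t u = u \<or> T_mult u t = u" "h \<in> carrier G"
    for h t u j
    using that by blast
  from mult have mult2: "h \<otimes> right_mult t j \<otimes> right_mult u (snd t j) = h \<otimes> right_mult (T_mult t u) j"
    if "linked t" "linked u" "T_mult t u = t \<or> T_mult u t = t" "h \<in> carrier G"
    for h t u j
    using that by blast
  have snd: "snd (T_mult t u) j = snd u (snd t j)" and fst: "fst (T_mult t u) i = fst t (fst u i)"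
    for t u :: "'a T" and i j
    by (simp_all add: T_mult_def)
  \<comment> \<open>The two representatives differ by the right factor from
    \<open>Base_transfer\<close>, which lies in \<open>H\<close>.\<close>
  have coset: "(h \<otimes> right_mult t j \<otimes> inv (entry (fst u (Inl None)) (snd t j))) <# H =
      (h \<otimes> inv (entry (fst t (fst u (Inl None))) j)) <# H"
    if "Base t \<in> carrier (B_GH R B)" "h \<in> carrier G" for h t u j
  proof -
    let ?i = "fst u (Inl None)"
    let ?x = "h \<otimes> inv (entry (fst t ?i) j)" and ?k = "entry (fst t ?i) (snd t j) \<otimes> inv (entry ?i (snd t j))"
    have "h \<otimes> right_mult t j \<otimes> inv (entry ?i (snd t j)) = ?x \<otimes> ?k"
      using that right_mult_eq[OF linked, of t j ?i] by (simp add: m_assoc)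
    moreover have "inv ?x \<otimes> (?x \<otimes> ?k) = ?k"
      using that by (intro inv_mult_cancel) simp_all
    moreover have "?k \<in> H" using Base_transfer[OF that(1)] .
    ultimately show ?thesis using l_coset_mult_H[of ?x "?x \<otimes> ?k"] that by simp
  qed
  show ?thesis
  proof (cases s)
    case None
    then show ?thesis by (cases e; cases f) (simp_all add: B_GH_def)
  next
    case (Some st)
    then obtain h j C where st: "s = Some (h, j, C)" "h \<in> carrier G"
      using s by (auto simp: states_def)
    have "step f (step e s) = step (?m e f) s"
      using carr basic' st
      by (cases e; cases f; simp add: linked mult mult1 mult2 snd fst const coset)
    then show ?thesis by (simp add: B_GH_def)
  qed
qed

lemma fold_step_eq:
  assumes "cl u = cl v" "set u \<subseteq> carrier (B_GH R B)" "s \<in> states"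
  shows "fold step u s = fold step v s"
  using assms step_closed step_basic
  by (intro IG_fold[of "B_GH R B" u v states step s]) (auto simp: carrier_E)

lemma step_K:
  "step (copy p (K_pair i j)) (Some (h, k, C)) = Some (h \<otimes> (inv (entry i k) \<otimes> entry i j), j,
     if p \<or> C \<noteq> None then C else Some ((h \<otimes> inv (entry i k)) <# H))"
  by (simp add: copy_def right_mult_def K_pair_def)

lemma fold_step_K_word:
  assumes "h \<in> carrier G"
  shows "fold step (K_word p w) (Some (h, Some None, C)) =
    Some (h \<otimes> val w, Some None, if p \<or> C \<noteq> None then C else Some (h <# H))"
proof -
  have "fold step (concat (map (\<lambda>(a, e).
      if e then [copy p (K_pair (Inr None) (Some (Some a))), copy p (K_pair (Inl None) (Some None))]
      else [copy p (K_pair (Inl None) (Some (Some a))), copy p (K_pair (Inr None) (Some None))]) w))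
      (Some (h, Some None, C)) = Some (h \<otimes> val w, Some None, C)"
    if "h \<in> carrier G" "p \<or> C \<noteq> None" for h C
    using that
  proof (induction w arbitrary: h)
    case (Cons x w)
    obtain a e where x: "x = (a, e)" by fastforce
    have "entry (Inr None) (Some (Some a)) = \<phi> a" by (simp add: entry_def gen_def)
    then show ?case
      using Cons by (cases e) (simp_all add: x step_K m_assoc)
  qed simp
  from this[OF assms, of "if p \<or> C \<noteq> None then C else Some (h <# H)"] show ?thesis
    using assms unfolding K_word_def fold_Cons o_apply step_K by (auto split: if_split_asm)
qed

section \<open>Faithfulness of the group component and the border criterion\<close>

lemma set_K_word: "set (K_word p w) \<subseteq> carrier (B_GH R B)"
  by (auto simp: K_word_def in_carrier split: if_splits)

lemma K_word_cong: "val u = val v \<Longrightarrow> cl (K_word p u) = cl (K_word p v)"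
  by (simp add: val_eq_iff K_word_pres_cong)

lemma rees_eq_cl:
  "rees p i w j = cl (copy p (K_pair i (Some None)) # K_word p w @ [copy p (K_pair (Inl None) j)])"
  by (simp add: rees_def IG_mult_class)

lemma rees_inj:
  assumes "rees p i u j = rees p i v j" shows "val u = val v"
proof -
  let ?w = "\<lambda>w. copy p (K_pair i (Some None)) # K_word p w @ [copy p (K_pair (Inl None) j)]"
  \<comment> \<open>With the coset already set it stays constant, and the final states differ at
    most in the group element.\<close>
  let ?s = "Some (\<one>, Some None, Some H) :: ('a, 'g) state"
  have "fold step (?w u) ?s = fold step (?w v) ?s"
    by (rule fold_step_eq) (use assms set_K_word in \<open>auto simp: rees_eq_cl in_carrier states_def\<close>)
  then show ?thesis by (simp add: step_K fold_step_K_word)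
qed

lemma rees_cong: "val u = val v \<Longrightarrow> rees p i u j = rees p i v j"
  unfolding rees_def using K_word_cong[of u v p] by simp

lemma border_iff:
  "cl (K_word True w @ [copy False (K_pair (Inl None) (Some None))])
    = cl (copy True (K_pair (Inl None) (Some None)) # K_word False w) \<longleftrightarrow> val w \<in> H"
    (is "cl ?u = cl ?v \<longleftrightarrow> _")
proof
  assume eq: "cl ?u = cl ?v"
  \<comment> \<open>With the coset unset, the first letter of the second copy records it: the left
    word after \<open>val w\<close>, the right word at the identity. The group elements at the end
    agree in any case.\<close>
  let ?s = "Some (\<one>, Some None, None) :: ('a, 'g) state"
  have "fold step ?u ?s = fold step ?v ?s"
    by (rule fold_step_eq[OF eq]) (use set_K_word in \<open>auto simp: in_carrier states_def\<close>)
  then have "val w <# H = \<one> <# H"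
    by (simp add: step_K fold_step_K_word)
  also have "\<dots> = H"
    by (simp add: lcos_mult_one subgroup.subset[OF subgroup])
  finally have "val w <# H = H" .
  moreover have "val w \<otimes> \<one> \<in> val w <# H"
    using subgroup.one_closed[OF subgroup] unfolding l_coset_def by blast
  ultimately show "val w \<in> H"
    by simp
next
  assume "val w \<in> H"
  then obtain w' where w': "set w' \<subseteq> B \<times> {False}" "val w' = val w" using val_H by metis
  have "cl ?u = cl (K_word True w') \<cdot> K False (Inl None) (Some None)"
    using K_word_cong[OF w'(2)] by (simp flip: IG_mult_class)
  also have "\<dots> = K True (Inl None) (Some None) \<cdot> cl (K_word False w')"
    by (rule K_word_transfer_list[OF w'(1)])
  also have "\<dots> = cl ?v"
    using K_word_cong[OF w'(2)] by (simp add: IG_mult_class)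
  finally show "cl ?u = cl ?v" .
qed

end


section \<open>Maximal subgroups\<close>

text \<open>Over the empty generating set the empty word is the only word, so the language has a
  single code.\<close>

lemma decidable_word_problem_trivial:
  assumes "group M" "carrier M = {\<one>\<^bsub>M\<^esub>}"
  shows "decidable_word_problem M"
proof -
  interpret M: group M by fact
  have "generate M {} = carrier M"
    using M.generate_empty assms(2) by simp
  moreover have "decidable_words ({} \<times> UNIV)
    {w \<in> lists ({} \<times> (UNIV :: bool set)). word_val M id w = \<one>\<^bsub>M\<^esub>}"
  proof -
    have "{w \<in> lists ({} \<times> (UNIV :: bool set)). word_val M id w = \<one>\<^bsub>M\<^esub>} = {[]}"
      by (auto simp: word_val_def)
    then show ?thesis
      unfolding decidable_words_def using recursive_set_singleton by simp
  qed
  ultimately show ?thesis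
    unfolding decidable_word_problem_def using assms(1) by blast
qed

text \<open>Generators are transported by \<open>h\<close>, and letters are numbered through the
  inverse of \<open>h\<close>; the set of codes to be decided is then literally the same.\<close>

lemma decidable_word_problem_iso:
  assumes G: "decidable_word_problem G" and M: "group M" and h: "h \<in> iso G M"
  shows "decidable_word_problem M"
proof -
  obtain X where X: "finite X" "X \<subseteq> carrier G" "generate G X = carrier G"
    and dec: "decidable_words (X \<times> UNIV) {w \<in> lists (X \<times> UNIV). word_val G id w = \<one>\<^bsub>G\<^esub>}"
    and "group G"
    using G unfolding decidable_word_problem_def by blast
  interpret G: group G by fact
  interpret M: group M by fact
  interpret group_hom G M h
    using h by unfold_locales (simp add: iso_def)
  have inj: "inj_on h (carrier G)" and surj: "h ` carrier G = carrier M"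
    using h by (auto simp: iso_def bij_betw_def)
  obtain c where c: "inj_on c (X \<times> UNIV)"
    "recursive_set ((\<lambda>w. list_encode (map c w)) ` {w \<in> lists (X \<times> UNIV). word_val G id w = \<one>\<^bsub>G\<^esub>})"
    using dec unfolding decidable_words_def by blast
  define k where "k = inv_into X h"
  have k: "k (h x) = x" if "x \<in> X" for x
    using that inj X(2) unfolding k_def by (meson inj_on_subset inv_into_f_f)
  let ?h = "map_prod h id :: _ \<times> bool \<Rightarrow> _" and ?k = "map_prod k id :: _ \<times> bool \<Rightarrow> _"
  have kh: "map ?k (map ?h w) = w" if "w \<in> lists (X \<times> UNIV)" for w
    using that by (induction w) (auto simp: k)
  have val: "word_val G id w \<in> carrier G \<and> word_val M id (map ?h w) = h (word_val G id w)"
    if "w \<in> lists (X \<times> UNIV)" for w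
    using that X(2) by (induction w) (auto simp: word_val_def letter_val_def)
  have "{w \<in> lists (h ` X \<times> UNIV). word_val M id w = \<one>\<^bsub>M\<^esub>}
      = map ?h ` {w \<in> lists (X \<times> UNIV). word_val G id w = \<one>\<^bsub>G\<^esub>}" (is "?l = ?r")
  proof (intro equalityI subsetI)
    fix w assume w: "w \<in> ?l"
    moreover have "?h ` (X \<times> UNIV) = h ` X \<times> UNIV" by force
    ultimately have "w \<in> lists (?h ` (X \<times> UNIV))" by simp
    then obtain w' where w': "w' \<in> lists (X \<times> UNIV)" "w = map ?h w'"
      unfolding lists_image by blast
    then have "h (word_val G id w') = h \<one>\<^bsub>G\<^esub>" using w val[OF w'(1)] by simp
    then have "word_val G id w' = \<one>\<^bsub>G\<^esub>" using inj val[OF w'(1)] by (metis G.one_closed inj_onD)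
    with w' show "w \<in> ?r" by blast
  next
    fix w assume "w \<in> ?r"
    then obtain w' where "w' \<in> lists (X \<times> UNIV)" "w = map ?h w'" "word_val G id w' = \<one>\<^bsub>G\<^esub>"
      by blast
    moreover from this have "w \<in> lists (h ` X \<times> UNIV)" by fastforce
    ultimately show "w \<in> ?l" using val[of w'] by simp
  qed
  then have "(\<lambda>w. list_encode (map (c \<circ> ?k) w)) ` ?l
      = (\<lambda>w. list_encode (map c (map ?k (map ?h w)))) ` {w \<in> lists (X \<times> UNIV). word_val G id w = \<one>\<^bsub>G\<^esub>}"
    by (simp add: image_image o_assoc)
  also have "\<dots> = (\<lambda>w. list_encode (map c w)) ` {w \<in> lists (X \<times> UNIV). word_val G id w = \<one>\<^bsub>G\<^esub>}"
    by (rule image_cong) (simp_all only: kh mem_Collect_eq)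
  finally have "recursive_set ((\<lambda>w. list_encode (map (c \<circ> ?k) w)) ` ?l)"
    using c(2) by simp
  moreover have "inj_on (c \<circ> ?k) (h ` X \<times> UNIV)"
  proof (rule comp_inj_on)
    show "inj_on ?k (h ` X \<times> UNIV)" by (rule inj_onI) (auto simp: k)
    have "?k ` (h ` X \<times> UNIV) \<subseteq> X \<times> UNIV" by (auto simp: k)
    then show "inj_on c (?k ` (h ` X \<times> UNIV))" by (rule inj_on_subset[OF c(1)])
  qed
  ultimately have "decidable_words (h ` X \<times> UNIV) ?l"
    unfolding decidable_words_def by blast
  moreover have "generate M (h ` X) = carrier M"
    using generate_img[OF X(2)] X(3) surj by simp
  moreover have "h ` X \<subseteq> carrier M" using X(2) surj by blast
  ultimately show ?thesis
    unfolding decidable_word_problem_def using M X(1) by blast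
qed

section \<open>Content and alternation invariants\<close>

lemma K_pair_neq_L_pair: "K_pair i j \<noteq> L_pair x y z"
proof
  assume "K_pair i j = L_pair x y z"
  then have "fst (K_pair i j) (Inl None) = fst (L_pair x y z) (Inl None)"
    "fst (K_pair i j) (Inr None) = fst (L_pair x y z) (Inr None)" by simp_all
  then show False by (simp add: K_pair_def L_pair_def)
qed

text \<open>The state holds the copy read last and the number of switches so far.\<close>

fun alternation :: "'s W \<Rightarrow> (bool \<times> nat) option \<Rightarrow> (bool \<times> nat) option" where
  "alternation (Base t) s = s"
| "alternation (Copy1 t) (Some (l, n)) = Some (True, if l then n else Suc n)"
| "alternation (Copy2 t) (Some (l, n)) = Some (False, if l then Suc n else n)"
| "alternation _ _ = None"

lemma fold_alternation:
  assumes "Zero \<notin> set w"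
  shows "\<exists>l' n'. fold alternation w (Some (l, n)) = Some (l', n') \<and> n \<le> n' \<and>
    (n' = n \<longrightarrow> l' = l \<and> set w \<subseteq> range Base \<union> range (copy l))"
  using assms
proof (induction w arbitrary: l n)
  case (Cons e w)
  then have w: "Zero \<notin> set w" by simp
  have "(\<exists>t. e = Base t) \<or> (\<exists>t. e = copy True t) \<or> (\<exists>t. e = copy False t)"
    using Cons.prems by (cases e) (auto simp: copy_def)
  then consider t where "e = Base t" | p t where "e = copy p t" by blast
  then show ?case
  proof cases
    case 1
    then show ?thesis using Cons.IH[OF w, of l n] by auto
  next
    case (2 p t)
    then have "alternation e (Some (l, n)) = Some (p, if p = l then n else Suc n)"
      by (auto simp: copy_def)
    then show ?thesis
      using Cons.IH[OF w, of p "if p = l then n else Suc n"] 2 by (auto split: if_splits)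
  qed
qed simp

context IG_band
begin

text \<open>Letters of different copies multiply to \<open>Zero\<close>, which is neither factor. So
  no basic pair straddles the copies, and no relation removes a switch.\<close>

lemma basic_alternation:
  assumes "basic_pair (B_GH R B) e f"
  shows "alternation f (alternation e s) = alternation (e \<odot>\<^bsub>B_GH R B\<^esub> f) s"
  using assms
  by (cases s; cases e; cases f) (auto simp: basic_pair_def B_GH_def)

lemma cl_content_Base:
  assumes "cl u = cl v" "set u \<subseteq> carrier (B_GH R B)"
  shows "set u \<subseteq> range Base \<longleftrightarrow> set v \<subseteq> range Base"
proof (rule IG_content[OF assms(1)])
  show "e \<odot>\<^bsub>B_GH R B\<^esub> f \<in> range Base \<longleftrightarrow> e \<in> range Base \<and> f \<in> range Base" for e f
    by (cases e; cases f) (auto simp: B_GH_def)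
qed (use assms(2) in \<open>auto simp: carrier_E\<close>)

lemma cl_content_copy:
  assumes "cl u = cl v" "set u \<subseteq> carrier (B_GH R B)"
  shows "set u \<subseteq> range Base \<union> range (copy p) \<longleftrightarrow> set v \<subseteq> range Base \<union> range (copy p)"
proof (rule IG_content[OF assms(1)])
  show "e \<odot>\<^bsub>B_GH R B\<^esub> f \<in> range Base \<union> range (copy p) \<longleftrightarrow>
      e \<in> range Base \<union> range (copy p) \<and> f \<in> range Base \<union> range (copy p)" for e f
    by (cases e; cases f) (auto simp: B_GH_def copy_def)
qed (use assms(2) in \<open>auto simp: carrier_E\<close>)

text \<open>\<open>K_H\<close> absorbs \<open>L_G\<close> in every product, and \<open>L_G\<close>
  is closed under products; hence no relation creates or removes the property of avoiding
  \<open>K_H\<close>.\<close>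

lemma cl_content_L:
  assumes "cl u = cl v" "set u \<subseteq> carrier (B_GH R B)"
  shows "set u \<subseteq> Base ` L_G R \<longleftrightarrow> set v \<subseteq> Base ` L_G R"
proof (rule IG_content[OF assms(1)])
  show "e \<odot>\<^bsub>B_GH R B\<^esub> f \<in> Base ` L_G R \<longleftrightarrow> e \<in> Base ` L_G R \<and> f \<in> Base ` L_G R"
    if "basic_pair (B_GH R B) e f" for e f
  proof (cases "e \<in> range Base \<and> f \<in> range Base")
    case True
    then obtain t u where tu: "e = Base t" "f = Base u" by blast
    have "t \<in> L_G R \<union> K_H B" "u \<in> L_G R \<union> K_H B"
      using that by (auto simp: basic_pair_def tu carrier_E) (auto simp: B_GH_def)
    then have "(\<exists>x y z. t = L_pair x y z \<and> t \<in> L_G R) \<or> (\<exists>a b. t = K_pair a b \<and> t \<notin> L_G R)"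
      "(\<exists>x y z. u = L_pair x y z \<and> u \<in> L_G R) \<or> (\<exists>a b. u = K_pair a b \<and> u \<notin> L_G R)"
      unfolding L_G_eq K_H_def using K_pair_neq_L_pair by blast+
    moreover have "K_pair i j \<notin> L_G R" for i j
      using K_pair_neq_L_pair unfolding L_G_eq by blast
    ultimately show ?thesis
      by (elim disjE exE conjE) (simp_all add: tu B_GH_def T_simps image_iff)
  next
    case False
    then show ?thesis by (cases e; cases f) (auto simp: B_GH_def)
  qed
qed (use assms(2) in \<open>auto simp: carrier_E\<close>)

section \<open>Normal forms of words with \<open>Zero\<close>, of \<open>Base\<close> words and of
  words in one copy\<close>

lemma Zero_left: "set w \<subseteq> carrier (B_GH R B) \<Longrightarrow> cl [Zero] \<cdot> cl w = cl [Zero]"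
proof (induction w)
  case (Cons x w)
  have "cl [Zero] \<cdot> cl [x] = cl [Zero]"
    using Cons.prems by (subst mul_basic) (auto simp: in_carrier)
  then have "cl [Zero] \<cdot> (cl [x] \<cdot> cl w) = cl [Zero]"
    using Cons by (simp flip: IG_mult_assoc)
  then show ?case by (simp add: IG_mult_class)
qed (simp add: IG_mult_class)

lemma Zero_right: "set w \<subseteq> carrier (B_GH R B) \<Longrightarrow> cl w \<cdot> cl [Zero] = cl [Zero]"
proof (induction w)
  case (Cons x w)
  have "W_mult T_mult x Zero = Zero" by (cases x) simp_all
  then have "cl [x] \<cdot> cl [Zero] = cl [Zero]"
    using Cons.prems by (subst mul_basic) (auto simp: in_carrier)
  then have "cl [x] \<cdot> cl w \<cdot> cl [Zero] = cl [Zero]"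
    using Cons by (simp add: IG_mult_assoc)
  then show ?case by (simp add: IG_mult_class)
qed (simp add: IG_mult_class)

lemma cl_Zero:
  assumes "Zero \<in> set w" "set w \<subseteq> carrier (B_GH R B)" shows "cl w = cl [Zero]"
proof -
  obtain u v where w: "w = u @ Zero # v" using assms(1) by (meson split_list)
  then have "cl w = cl u \<cdot> cl [Zero] \<cdot> cl v" by (simp add: IG_mult_class)
  then show ?thesis using assms(2) w by (simp add: Zero_left Zero_right)
qed

lemma cl_Base_letter:
  assumes "e \<in> carrier (B_GH R B)" "e \<in> range Base"
  shows "(\<exists>x y z. L_data R x y z \<and> cl [e] = L x y z) \<or> (\<exists>a b. b \<in> B1 \<and> cl [e] = KH a b)"
  using assms(1)
proof (cases rule: carrier_cases)
  case (K p i j)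
  then show ?thesis using assms(2) by (auto simp: copy_def split: if_splits)
qed (use assms(2) in blast)+

text \<open>Within \<open>L_G\<close> every product is its left factor, a mixed product lies in
  \<open>K_H\<close>, and \<open>K_H\<close> is a rectangular band even in \<open>IG\<close>; so
  such words collapse to one letter.\<close>

lemma cl_Base:
  assumes "w \<noteq> []" "set w \<subseteq> carrier (B_GH R B)" "set w \<subseteq> range Base"
  shows "(\<exists>x y z. L_data R x y z \<and> cl w = L x y z) \<or> (\<exists>a b. b \<in> B1 \<and> cl w = KH a b)"
  using assms
proof (induction w rule: list_nonempty_induct)
  case (single e)
  then show ?case using cl_Base_letter[of e] by simp
next
  case (cons e w)
  have eq: "cl (e # w) = cl [e] \<cdot> cl w" by (simp add: IG_mult_class)
  have "(\<exists>x y z. L_data R x y z \<and> cl [e] = L x y z) \<or> (\<exists>a b. b \<in> B1 \<and> cl [e] = KH a b)"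
    using cons cl_Base_letter[of e] by simp
  moreover have "(\<exists>x y z. L_data R x y z \<and> cl w = L x y z) \<or> (\<exists>a b. b \<in> B1 \<and> cl w = KH a b)"
    using cons by simp
  ultimately show ?case
  proof (elim disjE exE conjE)
    fix x y z x' y' z' assume "L_data R x y z" "cl [e] = L x y z" "L_data R x' y' z'" "cl w = L x' y' z'"
    then show ?thesis using L_L eq by auto
  next
    fix x y z a b assume "L_data R x y z" "cl [e] = L x y z" "b \<in> B1" "cl w = KH a b"
    then show ?thesis using L_KH(1)[of x y z b a] eq by (intro disjI2 exI[of _ x] exI[of _ b]) simp
  next
    fix x y z a b assume "L_data R x y z" "cl w = L x y z" "b \<in> B1" "cl [e] = KH a b"
    then show ?thesis using L_KH(2)[of x y z b a] eq by (intro disjI2 exI[of _ a] exI[of _ b]) simp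
  next
    fix a b a' b' assume "b \<in> B1" "cl [e] = KH a b" "b' \<in> B1" "cl w = KH a' b'"
    then show ?thesis using KH_KH[of b b' a a'] eq by (intro disjI2 exI[of _ a] exI[of _ b']) simp
  qed
qed

lemma Rees_Base:
  assumes "e \<in> carrier (B_GH R B)" "e \<in> range Base" "x \<in> Rees p"
  shows "cl [e] \<cdot> x \<in> Rees p" "x \<cdot> cl [e] \<in> Rees p"
proof -
  have "(\<exists>x y z. L_data R x y z \<and> cl [e] = L x y z) \<or> (\<exists>a b. b \<in> B1 \<and> cl [e] = KH a b)"
    using cl_Base_letter[of e] assms by simp
  then have "cl [e] \<cdot> x \<in> Rees p \<and> x \<cdot> cl [e] \<in> Rees p"
  proof (elim disjE exE conjE)
    fix a b c assume "L_data R a b c" "cl [e] = L a b c"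
    then show ?thesis using Rees_L[OF assms(3)] by simp
  next
    fix a b assume "b \<in> B1" "cl [e] = KH a b"
    then show ?thesis using Rees_KH[OF assms(3)] by simp
  qed
  then show "cl [e] \<cdot> x \<in> Rees p" "x \<cdot> cl [e] \<in> Rees p" by simp_all
qed

text \<open>One letter of the copy lands in \<open>Rees p\<close>, which absorbs \<open>Base\<close>
  letters on both sides and is closed under products.\<close>

lemma cl_Rees:
  assumes "set w \<subseteq> carrier (B_GH R B)" "set w \<subseteq> range Base \<union> range (copy p)" "\<not> set w \<subseteq> range Base"
  shows "cl w \<in> Rees p"
proof -
  have right: "x \<cdot> cl u \<in> Rees p"
    if "x \<in> Rees p" "set u \<subseteq> carrier (B_GH R B)" "set u \<subseteq> range Base" for x u
    using that
  proof (induction u arbitrary: x)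
    case Nil
    then obtain i w j where "x = rees p i w j" by (auto simp: Rees_def)
    then show ?case using Nil by (simp add: rees_def IG_mult_class)
  next
    case (Cons e u)
    then have "x \<cdot> cl [e] \<cdot> cl u \<in> Rees p" using Rees_Base(2) by simp
    then show ?case by (simp add: IG_mult_class IG_mult_assoc)
  qed
  show ?thesis using assms
  proof (induction w)
    case (Cons e w)
    have eq: "cl (e # w) = cl [e] \<cdot> cl w" by (simp add: IG_mult_class)
    show ?case
    proof (cases "e \<in> range Base")
      case True
      then show ?thesis using Cons Rees_Base(1) by (simp add: eq)
    next
      case False
      then obtain t where t: "e = copy p t" using Cons.prems by auto
      moreover have "copy p t \<notin> Base ` A \<union> {Zero}" for A by (auto simp: copy_def)
      moreover have "copy p t \<in> Copy1 ` A \<union> Copy2 ` A \<Longrightarrow> t \<in> A" for A by (auto simp: copy_def split: if_splits)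
      ultimately have "t \<in> K_G" using Cons.prems(1) unfolding B_GH_def by auto
      then have e: "cl [e] \<in> Rees p" using K_in_Rees by (auto simp: K_G_def t)
      show ?thesis
      proof (cases "set w \<subseteq> range Base")
        case True
        then show ?thesis using right[OF e] Cons.prems by (simp add: eq)
      next
        case False
        then show ?thesis using Cons Rees_mult[OF e] by (simp add: eq)
      qed
    qed
  qed simp
qed

lemma idempotent_content:
  assumes "cl w \<cdot> cl w = cl w" "set w \<subseteq> carrier (B_GH R B)" "Zero \<notin> set w"
  shows "\<exists>p. set w \<subseteq> range Base \<union> range (copy p)"
proof -
  have "cl (w @ w) = cl w" using assms(1) by (simp add: IG_mult_class)
  then have "fold alternation (w @ w) (Some (True, 0)) = fold alternation w (Some (True, 0))"
    by (rule IG_fold[where Q = UNIV]) (use assms(2) in \<open>auto simp: carrier_E basic_alternation\<close>)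
  moreover obtain p n where pn: "fold alternation w (Some (True, 0)) = Some (p, n)"
    using fold_alternation[OF assms(3)] by blast
  \<comment> \<open>A second reading of \<open>w\<close>, started where the first one ended, returns
    to the same state. It therefore contains no switch, and the letters from copies all belong to
    copy \<open>p\<close>.\<close>
  ultimately have "fold alternation w (Some (p, n)) = Some (p, n)"
    by simp
  then show ?thesis
    using fold_alternation[OF assms(3), of p n] by auto
qed

lemma IG_carrier_iff:
  "x \<in> carrier (IG \<E>) \<longleftrightarrow> (\<exists>w. w \<noteq> [] \<and> set w \<subseteq> carrier (B_GH R B) \<and> x = cl w)"
  by (auto simp: IG_def carrier_E)

end

context IG_band_group
begin

section \<open>\<H>-classes of idempotents\<close>

lemma rees_carrier: "rees p i w j \<in> carrier (IG \<E>)"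
proof -
  let ?w = "copy p (K_pair i (Some None)) # K_word p w @ [copy p (K_pair (Inl None) j)]"
  have "set ?w \<subseteq> carrier (B_GH R B)" using set_K_word[of p w] by (auto simp: in_carrier)
  moreover have "?w \<noteq> []" by simp
  ultimately show ?thesis unfolding IG_carrier_iff rees_eq_cl by blast
qed

text \<open>Since \<open>y\<close> divides \<open>x\<close>, it is a \<open>Base\<close> word
  whenever \<open>x\<close> is, and so a single letter. Elements of \<open>L_G\<close> are left
  zeros for one another and \<open>K_H\<close> is a rectangular band; in either case a two-sided
  identity for \<open>y\<close> equals \<open>y\<close>.\<close>

lemma H_class_trivial:
  assumes x: "x \<in> idempotents (IG \<E>)" "x = cl w" and w: "w \<noteq> []" "set w \<subseteq> carrier (B_GH R B)"
    and content: "Zero \<in> set w \<or> set w \<subseteq> range Base"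
  shows "H_class (IG \<E>) x = {x}"
proof -
  have "y = x" if y: "y \<in> H_class (IG \<E>) x" for y
  proof -
    have "y \<in> carrier (IG \<E>)" using y by (simp add: H_class_def)
    then obtain v where v: "v \<noteq> []" "set v \<subseteq> carrier (B_GH R B)" "y = cl v"
      unfolding IG_carrier_iff by blast
    obtain s where xy: "x \<cdot> y = y" "y \<cdot> x = y" "y \<cdot> s = x" "s \<in> carrier (IG \<E>)"
      using y IG_idempotent_H_class[OF x(1) \<open>y \<in> carrier (IG \<E>)\<close>] by blast
    obtain u where u: "s = cl u" "set u \<subseteq> carrier (B_GH R B)"
      using xy(4) unfolding IG_carrier_iff by blast
    have vu: "cl (v @ u) = cl w" "set (v @ u) \<subseteq> carrier (B_GH R B)"
      using xy(3) u v x(2) by (simp_all add: IG_mult_class)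
    show ?thesis
    proof (cases "Zero \<in> set w")
      case True
      then have "x = cl [Zero]" using cl_Zero[OF _ w(2)] unfolding x(2) by blast
      then show ?thesis using xy(1) Zero_left[OF v(2)] v(3) by simp
    next
      case False
      then have Base: "set w \<subseteq> range Base" using content by simp
      then have "set v \<subseteq> range Base" using cl_content_Base[OF vu] by simp
      then have y_cases: "(\<exists>a b c. L_data R a b c \<and> y = L a b c) \<or> (\<exists>a b. b \<in> B1 \<and> y = KH a b)"
        unfolding v(3) by (rule cl_Base[OF v(1,2)])
      from cl_Base[OF w Base] show ?thesis
      proof (elim disjE exE conjE)
        fix a b c assume L: "L_data R a b c" "cl w = L a b c"
        have "L_pair a b c \<in> L_G R" using L(1) unfolding L_G_eq by blast
        then have vL: "set v \<subseteq> Base ` L_G R"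
          using cl_content_L[OF vu(1)[unfolded L(2)] vu(2)] by simp
        have "y \<noteq> KH d e" for d e
        proof
          assume "y = KH d e"
          then have "Base (K_pair (Inl d) (Some e)) \<in> Base ` L_G R"
            using cl_content_L[OF _ v(2), of "[Base (K_pair (Inl d) (Some e))]"] vL v(3) by simp
          then show False using K_pair_neq_L_pair unfolding L_G_eq by blast
        qed
        then obtain a' b' c' where "L_data R a' b' c'" "y = L a' b' c'" using y_cases by blast
        then show "y = x" using L_L[OF L(1)] xy(1) unfolding x(2) L(2) by metis
      next
        fix a b assume KH: "b \<in> B1" "cl w = KH a b"
        from y_cases show "y = x"
        proof (elim disjE exE conjE)
          fix d e f assume "L_data R d e f" "y = L d e f"
          then show ?thesis using L_KH(2)[OF _ KH(1)] xy(1) unfolding x(2) KH(2) by metis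
        next
          fix d e assume y: "e \<in> B1" "y = KH d e"
          then have "y = KH d b" using KH_KH[OF y(1) KH(1)] xy(2) unfolding x(2) KH(2) by metis
          then show ?thesis using KH_KH[OF KH(1) KH(1)] xy(1) unfolding x(2) KH(2) by metis
        qed
      qed
    qed
  qed
  moreover have "x \<in> H_class (IG \<E>) x"
    using x(1) by (simp add: H_class_def idempotents_def)
  ultimately show ?thesis by blast
qed

lemma H_class_rees:
  assumes x: "x \<in> idempotents (IG \<E>)" "x = cl w" and w: "set w \<subseteq> carrier (B_GH R B)"
    and content: "set w \<subseteq> range Base \<union> range (copy p)" "\<not> set w \<subseteq> range Base"
  obtains i w0 j where "x = rees p i w0 j" "val w0 = entry i j"
    "H_class (IG \<E>) x = range (\<lambda>u. rees p i u j)"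
proof -
  obtain i w0 j where x': "x = rees p i w0 j"
    using cl_Rees[OF w content] x(2) by (auto simp: Rees_def)
  have xx: "x \<cdot> x = x" using x(1) by (simp add: idempotents_def)
  then have "val w0 \<otimes> (inv (entry i j) \<otimes> val w0) = val w0"
    using rees_inj[of p i "w0 @ sandwich j i @ w0" j w0]
    by (simp add: x' rees_mult val_sandwich)
  then have "inv (entry i j) \<otimes> val w0 = \<one>"
    by simp
  then have w0: "val w0 = entry i j"
    by (metis entry_closed inv_closed inv_equality inv_inv val_closed inv_comm)
  have "y \<in> range (\<lambda>u. rees p i u j)" if y: "y \<in> H_class (IG \<E>) x" for y
  proof -
    have yc: "y \<in> carrier (IG \<E>)" using y by (simp add: H_class_def)
    then obtain v where v: "set v \<subseteq> carrier (B_GH R B)" "y = cl v"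
      unfolding IG_carrier_iff by blast
    obtain s where xy: "x \<cdot> y = y" "y \<cdot> x = y" "y \<cdot> s = x" "s \<in> carrier (IG \<E>)"
      using y IG_idempotent_H_class[OF x(1) yc] by blast
    obtain u where u: "s = cl u" "set u \<subseteq> carrier (B_GH R B)"
      using xy(4) unfolding IG_carrier_iff by blast
    have "cl (v @ u) = cl w" "cl (w @ v) = cl v"
      using xy u v x(2) by (simp_all add: IG_mult_class)
    then have "set v \<subseteq> range Base \<union> range (copy p)" "\<not> set v \<subseteq> range Base"
      using cl_content_copy[of "v @ u" w p] cl_content_Base[of "w @ v" v] content u v w by auto
    then have "y \<in> Rees p" using cl_Rees v by simp
    then obtain k u' l where "y = rees p k u' l" by (auto simp: Rees_def)
    \<comment> \<open>Multiplying by the identity \<open>x\<close> on both sides forces row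
      \<open>i\<close> and column \<open>j\<close>.\<close>
    then have "y = rees p i w0 j \<cdot> rees p k u' l \<cdot> rees p i w0 j"
      using xy x' by simp
    then show ?thesis by (auto simp: rees_mult)
  qed
  moreover have "rees p i u j \<in> H_class (IG \<E>) x" for u
  proof -
    \<comment> \<open>Solutions of ups = w0 and tpu = w0 in the group, where p is the sandwich
      entry.\<close>
    let ?s = "rees p i (inv_word (sandwich j i) @ inv_word u @ w0) j"
      and ?t = "rees p i (w0 @ inv_word u @ inv_word (sandwich j i)) j"
    have "rees p i u j \<cdot> ?s = x" "?t \<cdot> rees p i u j = x"
      unfolding x' rees_mult by (auto intro!: rees_cong simp: val_sandwich w0 m_assoc inv_mult_cancel)
    moreover have "x \<cdot> rees p i u j = rees p i u j" "rees p i u j \<cdot> x = rees p i u j"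
      unfolding x' rees_mult by (auto intro!: rees_cong simp: val_sandwich w0 m_assoc inv_mult_cancel)
    ultimately show ?thesis
      using IG_idempotent_H_class[OF x(1) rees_carrier] rees_carrier by blast
  qed
  ultimately show thesis using that[OF x' w0] by blast
qed

lemma maximal_subgroup_iso:
  assumes "x \<in> idempotents (IG \<E>)" "x = rees p i w0 j" "val w0 = entry i j"
    and H: "H_class (IG \<E>) x = range (\<lambda>u. rees p i u j)"
  shows "group (maximal_subgroup (IG \<E>) x) \<and> (\<exists>h. h \<in> iso G (maximal_subgroup (IG \<E>) x))"
proof -
  let ?M = "maximal_subgroup (IG \<E>) x"
  define wd where "wd g = (SOME w. val w = g)" for g
  have wd: "val (wd g) = g" if "g \<in> carrier G" for g
    unfolding wd_def using someI_ex[OF val_surj[OF that]] .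
  \<comment> \<open>The factor \<open>w0\<close> is the inverse of the sandwich entry and cancels
    the one that appears between the factors of a product.\<close>
  define h where "h g = rees p i (wd g @ w0) j" for g
  have carr: "carrier ?M = range (\<lambda>u. rees p i u j)" and one: "\<one>\<^bsub>?M\<^esub> = x"
    by (simp_all add: maximal_subgroup_def H)
  have "h \<in> hom G ?M"
    unfolding hom_def carr
    by (auto simp: h_def maximal_subgroup_def rees_mult val_sandwich assms(3) wd m_assoc inv_mult_cancel
        intro!: rees_cong)
  moreover have surj: "h ` carrier G = carrier ?M"
  proof (intro equalityI subsetI)
    fix y assume "y \<in> carrier ?M"
    then obtain u where y: "y = rees p i u j" unfolding carr by blast
    have "h (val u \<otimes> inv (entry i j)) = y"
      unfolding h_def y by (rule rees_cong) (simp add: wd assms(3) m_assoc)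
    then show "y \<in> h ` carrier G" by (metis entry_closed imageI inv_closed m_closed val_closed)
  qed (auto simp: h_def carr)
  moreover have "inj_on h (carrier G)"
  proof (rule inj_onI)
    fix g g' assume g: "g \<in> carrier G" "g' \<in> carrier G" "h g = h g'"
    then have "val (wd g @ w0) = val (wd g' @ w0)" unfolding h_def by (intro rees_inj)
    then show "g = g'" using g by (simp add: wd)
  qed
  ultimately have iso: "h \<in> iso G ?M" by (simp add: iso_def bij_betw_def)
  have "h \<one> = x"
    unfolding h_def assms(2) by (rule rees_cong) (simp add: wd)
  \<comment> \<open>\<open>iso_imp_img_group\<close> provides the group structure with
    \<open>h \<one>\<close> as identity, which has to be matched with the given identity
    \<open>x\<close>.\<close>
  then have "?M\<lparr>one := h \<one>\<rparr> = ?M"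
    by (simp add: maximal_subgroup_def)
  then have "group ?M"
    using iso_imp_img_group[OF iso] by simp
  with iso show ?thesis by blast
qed

lemma maximal_subgroup_cases:
  assumes "M \<in> maximal_subgroups (IG \<E>)"
  shows "group M \<and> (carrier M = {\<one>\<^bsub>M\<^esub>} \<or> (\<exists>h. h \<in> iso G M))"
proof -
  obtain x where x: "x \<in> idempotents (IG \<E>)" "M = maximal_subgroup (IG \<E>) x"
    using assms unfolding maximal_subgroups_def by blast
  then have "x \<in> carrier (IG \<E>)" and xx: "x \<cdot> x = x"
    unfolding idempotents_def by blast+
  then obtain w where w: "w \<noteq> []" "set w \<subseteq> carrier (B_GH R B)" "x = cl w"
    unfolding IG_carrier_iff by blast
  show ?thesis
  proof (cases "Zero \<in> set w \<or> set w \<subseteq> range Base")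
    case True
    then have "H_class (IG \<E>) x = {x}" by (rule H_class_trivial[OF x(1) w(3,1,2)])
    then have M: "carrier M = {x}" "\<one>\<^bsub>M\<^esub> = x" "x \<otimes>\<^bsub>M\<^esub> x = x"
      using xx by (simp_all add: x(2) maximal_subgroup_def)
    have "group M"
      by (rule groupI) (simp_all only: M singleton_iff, simp_all add: M)
    then show ?thesis using M by simp
  next
    case False
    have "cl w \<cdot> cl w = cl w" using xx unfolding w(3) .
    then obtain p where p: "set w \<subseteq> range Base \<union> range (copy p)" "\<not> set w \<subseteq> range Base"
      using idempotent_content[of w] w(2) False by blast
    obtain i w0 j where "x = rees p i w0 j" "val w0 = entry i j"
      "H_class (IG \<E>) x = range (\<lambda>u. rees p i u j)"
      by (rule H_class_rees[OF x(1) w(3,2) p])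
    from maximal_subgroup_iso[OF x(1) this] show ?thesis
      unfolding x(2) by blast
  qed
qed

end


section \<open>The word problem\<close>

context IG_band_group
begin

text \<open>Folding over a code reverses the order of letters. Passing to the inverse word makes
  this reversal the desired one, and \<open>H\<close> is closed under inverses.\<close>

lemma border_mem_iff:
  "(K_word True (inv_word w) @ [copy False (K_pair (Inl None) (Some None))],
    copy True (K_pair (Inl None) (Some None)) # K_word False (inv_word w))
    \<in> {(u, v). u \<in> lists (carrier \<E>) - {[]} \<and> v \<in> lists (carrier \<E>) - {[]} \<and> cl u = cl v}
    \<longleftrightarrow> val w \<in> H"
proof -
  have "K_word p v \<in> lists (carrier \<E>)" for p v
    using set_K_word by (auto simp: carrier_E)
  moreover have "inv (val w) \<in> H \<longleftrightarrow> val w \<in> H"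
    using subgroup.m_inv_closed[OF subgroup] by (metis inv_inv val_closed)
  ultimately show ?thesis
    using border_iff[of "inv_word w"] by (auto simp: carrier_E in_carrier)
qed

lemma decidable_membership_if:
  assumes "IG_decidable_word_problem \<E>" shows "decidable_membership G \<phi> H"
proof -
  let ?P = "{(u, v). u \<in> lists (carrier \<E>) - {[]} \<and> v \<in> lists (carrier \<E>) - {[]} \<and> cl u = cl v}"
  obtain c where c: "inj_on c (carrier \<E>)"
    and rec: "recursive_set ((\<lambda>(u, v). prod_encode (list_encode (map c u), list_encode (map c v))) ` ?P)"
      (is "recursive_set ?S")
    using assms unfolding IG_decidable_word_problem_def decidable_word_pairs_def by blast
  \<comment> \<open>The numbering of group letters is free to choose; taking an initial segment of
    the numbers makes the letter substitution a finite table.\<close>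
  obtain c' :: "'a \<times> bool \<Rightarrow> nat" where c': "bij_betw c' UNIV {0..<card (UNIV :: ('a \<times> bool) set)}"
    using ex_bij_betw_finite_nat[OF finite] by blast
  define N where "N = card (UNIV :: ('a \<times> bool) set)"
  define d where "d = inv_into UNIV c'"
  have d: "d (c' x) = x" for x
    using c' by (simp add: d_def bij_betw_def)
  have cd: "c' (d n) = n" if "n < N" for n
    using that c' unfolding d_def N_def by (intro f_inv_into_f) (auto simp: bij_betw_def)
  have c'N: "c' x < N" for x
    using c' unfolding N_def bij_betw_def by auto
  have "finite (c ` carrier \<E>)"
    using finite_B_GH[of R B] by (simp add: carrier_E)
  then obtain q where q: "q \<notin> c ` carrier \<E>"
    using ex_new_if_finite infinite_UNIV_nat by metis
  let ?k = "\<lambda>p. copy p (K_pair (Inl None) (Some None)) :: 'a T W"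
  let ?b = "\<lambda>p (a, e). if e then [copy p (K_pair (Inr None) (Some (Some a))), ?k p]
     else [copy p (K_pair (Inl None) (Some (Some a))), copy p (K_pair (Inr None) (Some None))]"
  let ?t = "\<lambda>p x. map c (?b p (case d x of (a, e) \<Rightarrow> (a, \<not> e)))"
  define U where "U p xs ys = concat (map (\<lambda>x. if x < N then ?t p x else [q]) (rev xs)) @ ys"
    for p xs ys
  \<comment> \<open>The reduction: \<open>n\<close> goes to the code of the two border words for the
    inverse of the word coded by \<open>n\<close>. The leading letters of \<open>K_word\<close> are
    added outside \<open>U\<close>, which only produces the blocks.\<close>
  define g where "g n = prod_encode (list_encode (c (?k True) # U True (list_decode n) [c (?k False)]),
    list_encode (c (?k True) # c (?k False) # U False (list_decode n) []))" for n
  have "computable 1 (\<lambda>xs. g (xs ! 0))"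
    unfolding g_def U_def list_encode.simps
    by (intro computable_prod_encode computable_Suc computable_const computable_reverse_substitution
        computable_proj) simp_all
  moreover have "n \<in> (\<lambda>w. list_encode (map c' w)) ` {w. val w \<in> H} \<longleftrightarrow> g n \<in> ?S" for n
  proof (cases "\<forall>x\<in>set (list_decode n). x < N")
    case True
    define w where "w = map d (list_decode n)"
    have n: "n = list_encode (map c' w)"
    proof -
      have "map c' w = list_decode n"
        using True cd by (simp add: w_def map_idI)
      then show ?thesis by simp
    qed
    have "inj c'" using c' by (simp add: bij_betw_def)
    then have mem: "n \<in> (\<lambda>w. list_encode (map c' w)) ` {w. val w \<in> H} \<longleftrightarrow> val w \<in> H"
      unfolding n by (auto simp: inj_map_eq_map list_encode_eq)
    have U: "c (?k p) # U p (list_decode n) ys = map c (K_word p (inv_word w)) @ ys" for p ys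
    proof -
      have "U p (list_decode n) ys = concat (map (?t p) (rev (list_decode n))) @ ys"
        unfolding U_def using True by (intro arg_cong2[where f = append] arg_cong[where f = concat] map_cong) simp_all
      also have "concat (map (?t p) (rev (list_decode n))) = map c (concat (map (?b p) (inv_word w)))"
        by (simp add: inv_word_def w_def map_concat rev_map comp_def)
      finally show ?thesis by (simp add: K_word_def)
    qed
    define u where "u = K_word True (inv_word w) @ [?k False]"
    define v where "v = ?k True # K_word False (inv_word w)"
    have g: "g n = prod_encode (list_encode (map c u), list_encode (map c v))"
      unfolding g_def U u_def v_def by simp
    have uv: "u \<in> lists (carrier \<E>)" "v \<in> lists (carrier \<E>)"
      using set_K_word[of True "inv_word w"] set_K_word[of False "inv_word w"]
      by (auto simp: carrier_E in_carrier u_def v_def)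
    have inj: "x = y" if "map c x = map c y" "x \<in> lists (carrier \<E>)" "y \<in> lists (carrier \<E>)" for x y
      using that by (intro map_inj_on[OF that(1)] inj_on_subset[OF c]) auto
    have "g n \<in> ?S \<longleftrightarrow> (u, v) \<in> ?P"
    proof
      assume "g n \<in> ?S"
      then obtain u' v' where P: "(u', v') \<in> ?P"
        and "g n = prod_encode (list_encode (map c u'), list_encode (map c v'))"
        by (elim imageE) auto
      then have eq: "map c u = map c u'" "map c v = map c v'"
        unfolding g by (simp_all only: prod_encode_eq list_encode_eq prod.inject)
      have "u = u'" "v = v'"
        using inj[OF eq(1) uv(1)] inj[OF eq(2) uv(2)] P by simp_all
      with P show "(u, v) \<in> ?P" by simp
    next
      assume "(u, v) \<in> ?P"
      then show "g n \<in> ?S" by (rule rev_image_eqI) (simp add: g)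
    qed
    moreover have "(u, v) \<in> ?P \<longleftrightarrow> val w \<in> H"
      unfolding u_def v_def by (rule border_mem_iff)
    ultimately show ?thesis using mem by blast
  next
    case False
    then obtain x where x: "x \<in> set (list_decode n)" "\<not> x < N" by blast
    have "n \<notin> (\<lambda>w. list_encode (map c' w)) ` {w. val w \<in> H}"
      using x c'N by auto
    \<comment> \<open>An entry that is no letter number leaves the mark \<open>q\<close>, which is
      not the code of any letter of the band.\<close>
    moreover have "g n \<notin> ?S"
    proof
      assume "g n \<in> ?S"
      then obtain u v where P: "u \<in> lists (carrier \<E>)"
        and "g n = prod_encode (list_encode (map c u), list_encode (map c v))"
        by (elim imageE) auto
      then have "c (?k True) # U True (list_decode n) [c (?k False)] = map c u"
        unfolding g_def by (simp only: prod_encode_eq list_encode_eq prod.inject)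
      moreover have "q \<in> set (U True (list_decode n) [c (?k False)])"
        unfolding U_def using x by force
      ultimately have "q \<in> set (map c u)" by (metis list.set_intros(2))
      then show False using q P by auto
    qed
    ultimately show ?thesis by blast
  qed
  ultimately have "recursive_set ((\<lambda>w. list_encode (map c' w)) ` {w. val w \<in> H})"
    by (rule recursive_set_vimage[OF rec])
  then show ?thesis
    unfolding decidable_membership_def decidable_words_def
    using c' by (auto simp: bij_betw_def)
qed

end

theorem theorem5p3:
  fixes G :: "'g monoid" and \<phi> :: "'a::finite \<Rightarrow> 'g"
    and R :: "('a \<times> 'a \<times> 'a) set" and H :: "'g set" and B :: "'a set"
  assumes presentation: "group_presentation G \<phi> (triple_relations R)"
    and subgroup: "subgroup H G"
    and generators: "generate G (\<phi> ` B) = H"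
    and inverses: "\<forall>b\<in>B. inv\<^bsub>G\<^esub> (\<phi> b) \<in> \<phi> ` B"
    and word_problem: "decidable_word_problem G"
    and membership: "\<not> decidable_membership G \<phi> H"
  shows "(\<forall>M \<in> maximal_subgroups (IG (biordered_set (B_GH R B))).
            (carrier M \<noteq> {\<one>\<^bsub>M\<^esub>} \<longrightarrow> M \<cong> G) \<and> decidable_word_problem M)
       \<and> \<not> IG_decidable_word_problem (biordered_set (B_GH R B))"
proof -
  have "group G" using presentation by (simp add: group_presentation_def)
  then interpret IG_band_group R B G \<phi> H
    using presentation subgroup generators inverses
    by (intro IG_band_group.intro IG_band_group_axioms.intro)
  have "(carrier M \<noteq> {\<one>\<^bsub>M\<^esub>} \<longrightarrow> M \<cong> G) \<and> decidable_word_problem M"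
    if M: "M \<in> maximal_subgroups (IG \<E>)" for M
  proof (cases "carrier M = {\<one>\<^bsub>M\<^esub>}")
    case True
    then show ?thesis
      using maximal_subgroup_cases[OF M] decidable_word_problem_trivial by blast
  next
    case False
    then obtain h where "group M" "h \<in> iso G M"
      using maximal_subgroup_cases[OF M] by blast
    then show ?thesis
      using iso_sym[of M] decidable_word_problem_iso[OF word_problem] by (auto simp: is_iso_def)
  qed
  then show ?thesis
    using decidable_membership_if membership by blast
qed

end
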